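(* Let $B$ be a unital C*-algebra. Every finitely generated projective $B$-module $\mathcal{M}$ can be reconstructed up to isomorphism from the following data: (i) a finite set of algebraic non-zero modular generators $\{x_1,\dots,x_k\}$ of $\mathcal{M}$; (ii) the symmetric $k\times k$ matrix $(a_{ij})$ of elements of $B$ with $a_{ij}=\langle x_i,x_j\rangle_0$ for $i,j=1,\dots,k$, where $\langle\cdot,\cdot\rangle_0$ is the (existing and unique) $B$-valued inner product on $\mathcal{M}$ that turns the set of algebraic modular generators $\{x_1,\dots,x_k\}$ into a normalized tight modular frame of the Hilbert $B$-module $\{\mathcal{M},\langle\cdot,\cdot\rangle_0\}$. That is: for each finite set of non-zero generators $\{x_1,\dots,x_k\}$ of $\mathcal{M}$ such an inner product $\langle\cdot,\cdot\rangle_0$ exists and is unique; and if $\mathcal{M}$ and $\mathcal{N}$ are finitely generated projective $B$-modules with sets of non-zero generators $\{x_1,\dots,x_k\}$ and $\{y_1,\dots,y_k\}$, respectively, whose associated matrices coincide, then $\mathcal{M}$ and $\mathcal{N}$ are isomorphic as $B$-modules. Moreover, the number of elements in sets of algebraic modular generators of $\mathcal{M}$ has a minimum, and it suffices to consider sets of generators of minimal length.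
   Context: Modules are left modules. A $B$-valued inner product on a $B$-module $\mathcal{M}$ turning it into a Hilbert $B$-module is a map $\langle\cdot,\cdot\rangle:\mathcal{M}\times\mathcal{M}\to B$ such that $\langle x,x\rangle\ge 0$; $\langle x,x\rangle=0$ iff $x=0$; $\langle x,y\rangle=\langle y,x\rangle^*$; $\langle ax+by,z\rangle=a\langle x,z\rangle+b\langle y,z\rangle$ for $a,b\in B$, $x,y,z\in\mathcal{M}$; and $\mathcal{M}$ is complete for the norm $\|x\|=\|\langle x,x\rangle\|_B^{1/2}$. A finite set $\{x_1,\dots,x_k\}\subset\mathcal{M}$ is a set of algebraic modular generators if every element of $\mathcal{M}$ is of the form $\sum_i b_ix_i$ with $b_i\in B$. A $k$-tuple $\{x_1,\dots,x_k\}$ is a normalized tight modular frame of $\{\mathcal{M},\langle\cdot,\cdot\rangle\}$ if $\langle x,x\rangle=\sum_{i=1}^k\langle x,x_i\rangle\langle x_i,x\rangle$ for every $x\in\mathcal{M}$. A matrix $(a_{ij})$ over $B$ is called symmetric here in the sense $a_{ij}=a_{ji}^*$. *)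

theory Defs
  imports Complex_Main
begin

(* Unital C*-algebras. As usual for unital Banach algebras the unit is normalised (norm 1 = 1),
   so the zero algebra is excluded. *)
class unital_cstar_algebra = real_normed_algebra_1 + banach +
  fixes scaleC :: "complex \<Rightarrow> 'a \<Rightarrow> 'a"
    and star :: "'a \<Rightarrow> 'a"
  assumes scaleC_add_right: "scaleC c (a + b) = scaleC c a + scaleC c b"
    and scaleC_add_left: "scaleC (c + d) a = scaleC c a + scaleC d a"
    and scaleC_scaleC: "scaleC c (scaleC d a) = scaleC (c * d) a"
    and scaleR_eq_scaleC: "scaleR r a = scaleC (complex_of_real r) a"
    and mult_scaleC_left: "scaleC c a * b = scaleC c (a * b)"
    and mult_scaleC_right: "a * scaleC c b = scaleC c (a * b)"
    and norm_scaleC: "norm (scaleC c a) = cmod c * norm a"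
    and star_star: "star (star a) = a"
    and star_add: "star (a + b) = star a + star b"
    and star_mult: "star (a * b) = star b * star a"
    and star_scaleC: "star (scaleC c a) = scaleC (cnj c) (star a)"
    and norm_star_mult: "norm (star a * a) = (norm a)\<^sup>2"

instantiation complex :: unital_cstar_algebra
begin
definition scaleC_complex :: "complex \<Rightarrow> complex \<Rightarrow> complex" where "scaleC_complex c a = c * a"
definition star_complex :: "complex \<Rightarrow> complex" where "star_complex = cnj"
instance
  by standard
    (simp_all add: scaleC_complex_def star_complex_def algebra_simps norm_mult power2_eq_square
      scaleR_conv_of_real)
end

definition spectrum :: "'b::unital_cstar_algebra \<Rightarrow> complex set" where
  "spectrum a = {z. \<not> (\<exists>b. (a - scaleC z 1) * b = 1 \<and> b * (a - scaleC z 1) = 1)}"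

definition positive :: "'b::unital_cstar_algebra \<Rightarrow> bool" where
  "positive a \<longleftrightarrow> star a = a \<and> (\<forall>z\<in>spectrum a. \<exists>r\<ge>0. z = complex_of_real r)"

(* The library locale module is restricted to commutative coefficient rings. *)
locale left_module =
  fixes smult :: "'b::ring_1 \<Rightarrow> 'm::ab_group_add \<Rightarrow> 'm"
  assumes smult_add_right: "smult a (x + y) = smult a x + smult a y"
    and smult_add_left: "smult (a + b) x = smult a x + smult b x"
    and smult_smult: "smult a (smult b x) = smult (a * b) x"
    and smult_one: "smult 1 x = x"

definition isomorphic_modules ::
  "('b::ring_1 \<Rightarrow> 'm::ab_group_add \<Rightarrow> 'm) \<Rightarrow> ('b \<Rightarrow> 'n::ab_group_add \<Rightarrow> 'n) \<Rightarrow> bool" where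
  "isomorphic_modules sM sN \<longleftrightarrow>
     (\<exists>f. bij f \<and> (\<forall>x y. f (x + y) = f x + f y) \<and> (\<forall>b x. f (sM b x) = sN b (f x)))"

(* The free left module of rank n: sequences vanishing from index n on, with pointwise operations. *)
definition free_module :: "nat \<Rightarrow> (nat \<Rightarrow> 'b::ring_1) set" where
  "free_module n = {v. \<forall>i\<ge>n. v i = 0}"

definition free_submodule :: "nat \<Rightarrow> (nat \<Rightarrow> 'b::ring_1) set \<Rightarrow> bool" where
  "free_submodule n P \<longleftrightarrow> P \<subseteq> free_module n \<and> (\<lambda>_. 0) \<in> P \<and>
     (\<forall>u\<in>P. \<forall>v\<in>P. (\<lambda>i. u i + v i) \<in> P) \<and> (\<forall>b. \<forall>v\<in>P. (\<lambda>i. b * v i) \<in> P)"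

(* Finitely generated projective: isomorphic to a direct summand P of a free module of finite rank,
   with complementary submodule Q. *)
definition fg_projective :: "('b::ring_1 \<Rightarrow> 'm::ab_group_add \<Rightarrow> 'm) \<Rightarrow> bool" where
  "fg_projective smult \<longleftrightarrow> left_module smult \<and>
     (\<exists>n P Q. free_submodule n P \<and> free_submodule n Q \<and> P \<inter> Q = {\<lambda>_. 0} \<and>
        (\<forall>v\<in>free_module n. \<exists>p\<in>P. \<exists>q\<in>Q. v = (\<lambda>i. p i + q i)) \<and>
        (\<exists>f. bij_betw f UNIV P \<and>
             (\<forall>x y. f (x + y) = (\<lambda>i. f x i + f y i)) \<and>
             (\<forall>b x. f (smult b x) = (\<lambda>i. b * f x i))))"

definition modular_generators ::
  "('b::ring_1 \<Rightarrow> 'm::ab_group_add \<Rightarrow> 'm) \<Rightarrow> 'm set \<Rightarrow> bool" where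
  "modular_generators smult X \<longleftrightarrow> finite X \<and> (\<forall>m. \<exists>b. m = (\<Sum>x\<in>X. smult (b x) x))"

(* Indexed as x 0, ..., x (k - 1); values of x outside this range are irrelevant. *)
definition nonzero_generators ::
  "('b::ring_1 \<Rightarrow> 'm::ab_group_add \<Rightarrow> 'm) \<Rightarrow> nat \<Rightarrow> (nat \<Rightarrow> 'm) \<Rightarrow> bool" where
  "nonzero_generators smult k x \<longleftrightarrow> modular_generators smult (x ` {..<k}) \<and> (\<forall>i<k. x i \<noteq> 0)"

definition minimal_nonzero_generators ::
  "('b::ring_1 \<Rightarrow> 'm::ab_group_add \<Rightarrow> 'm) \<Rightarrow> nat \<Rightarrow> (nat \<Rightarrow> 'm) \<Rightarrow> bool" where
  "minimal_nonzero_generators smult k x \<longleftrightarrow> nonzero_generators smult k x \<and>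
     (\<forall>Y. modular_generators smult Y \<longrightarrow> k \<le> card Y)"

definition ip_norm :: "('m \<Rightarrow> 'm \<Rightarrow> 'b::unital_cstar_algebra) \<Rightarrow> 'm \<Rightarrow> real" where
  "ip_norm ip x = sqrt (norm (ip x x))"

locale hilbert_module = left_module smult
  for smult :: "'b::unital_cstar_algebra \<Rightarrow> 'm::ab_group_add \<Rightarrow> 'm" +
  fixes ip :: "'m \<Rightarrow> 'm \<Rightarrow> 'b"
  assumes ip_positive: "positive (ip x x)"
    and ip_eq_0_iff: "ip x x = 0 \<longleftrightarrow> x = 0"
    and ip_star: "ip x y = star (ip y x)"
    and ip_linear: "ip (smult a x + smult b y) z = a * ip x z + b * ip y z"
    and ip_complete:
      "(\<forall>e>0. \<exists>N. \<forall>m\<ge>N. \<forall>n\<ge>N. ip_norm ip (X m - X n) < e) \<Longrightarrow>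
         \<exists>l. (\<lambda>n. ip_norm ip (X n - l)) \<longlonglongrightarrow> 0"

definition normalized_tight_frame ::
  "('m \<Rightarrow> 'm \<Rightarrow> 'b::unital_cstar_algebra) \<Rightarrow> nat \<Rightarrow> (nat \<Rightarrow> 'm) \<Rightarrow> bool" where
  "normalized_tight_frame ip k x \<longleftrightarrow> (\<forall>v. ip v v = (\<Sum>i<k. ip v (x i) * ip (x i) v))"

definition frame_inner_product ::
  "('b::unital_cstar_algebra \<Rightarrow> 'm::ab_group_add \<Rightarrow> 'm) \<Rightarrow> nat \<Rightarrow> (nat \<Rightarrow> 'm) \<Rightarrow> 'm \<Rightarrow> 'm \<Rightarrow> 'b" where
  "frame_inner_product smult k x =
     (THE ip. hilbert_module smult ip \<and> normalized_tight_frame ip k x)"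

(* Only the entries with i, j < k matter. *)
definition frame_matrix ::
  "('b::unital_cstar_algebra \<Rightarrow> 'm::ab_group_add \<Rightarrow> 'm) \<Rightarrow> nat \<Rightarrow> (nat \<Rightarrow> 'm) \<Rightarrow> nat \<Rightarrow> nat \<Rightarrow> 'b" where
  "frame_matrix smult k x i j = frame_inner_product smult k x (x i) (x j)"

end

theory Submission
  imports Defs "HOL-Library.Function_Algebras"
begin

text \<open>
Writing elements of \<open>M\<close> in terms of the generators gives an idempotent matrix \<open>q\<close> over \<open>B\<close>: if
\<open>m = \<Sum>\<^sub>i s\<^sub>i(m) x\<^sub>i\<close> with linear \<open>s\<^sub>i\<close> (a dual basis, by projectivity), then \<open>q\<^sub>i\<^sub>j = s\<^sub>j(x\<^sub>i)\<close>. Let \<open>p\<close>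
be the orthogonal projection with the same range. The coordinates \<open>t = s p\<close> embed \<open>M\<close> into \<open>B\<^sup>k\<close> and
\<open>\<langle>v, w\<rangle>\<^sub>0 = \<Sum>\<^sub>j t\<^sub>j(v) t\<^sub>j(w)\<^sup>*\<close> is the required inner product, with Gram matrix \<open>p\<close>. Conversely, a tight
frame satisfies \<open>v = \<Sum>\<^sub>i \<langle>v, x\<^sub>i\<rangle> x\<^sub>i\<close>; expanding one argument with each of two such inner products
shows that they agree, and \<open>v \<mapsto> \<Sum>\<^sub>i \<langle>v, x\<^sub>i\<rangle> y\<^sub>i\<close> is an isomorphism when the Gram matrices agree.

The matrix algebra is never normed: the only matrix to be inverted is of the form \<open>1 + a a\<^sup>*\<close>, and
elimination reduces this to the invertibility of \<open>1 + c\<close> for positive \<open>c\<close> in \<open>B\<close>.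
\<close>

section \<open>Positive elements of C*-algebras\<close>

lemma norm_star [simp]: "norm (star (a::'b::unital_cstar_algebra)) = norm a"
proof -
  have le: "norm a \<le> norm (star a)" for a :: 'b
  proof (cases "a = 0")
    case False
    have "norm a * norm a \<le> norm (star a) * norm a"
      using norm_star_mult[of a] norm_mult_ineq[of "star a" a] by (simp add: power2_eq_square)
    with False show ?thesis by simp
  qed simp
  show ?thesis using le[of a] le[of "star a"] by (simp add: star_star)
qed

lemma star_0 [simp]: "star (0::'b::unital_cstar_algebra) = 0"
  using star_add[of "0::'b" 0] by simp

lemma star_1 [simp]: "star (1::'b::unital_cstar_algebra) = 1"
  by (metis mult_1_right mult_1_left star_mult star_star)

lemma star_scaleR [simp]: "star (scaleR r a) = scaleR r (star (a::'b::unital_cstar_algebra))"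
  by (simp add: scaleR_eq_scaleC star_scaleC)

lemma star_minus [simp]: "star (- a) = - star (a::'b::unital_cstar_algebra)"
  using star_scaleR[of "-1" a] by simp

lemma star_diff [simp]: "star (a - b) = star a - star (b::'b::unital_cstar_algebra)"
  using star_add[of a "- b"] by simp

lemma star_sum: "star (sum f A) = (\<Sum>i\<in>A. star (f i :: 'b::unital_cstar_algebra))"
  by (induction A rule: infinite_finite_induct) (auto simp: star_add)

lemma bounded_linear_star: "bounded_linear (star :: 'b::unital_cstar_algebra \<Rightarrow> 'b)"
  by (rule bounded_linear_intro[where K = 1]) (auto simp: star_add)

lemma scaleC_minus_left: "scaleC (- c) a = - scaleC c (a::'b::unital_cstar_algebra)"
  using scaleC_scaleC[of "-1" c a] scaleR_eq_scaleC[of "-1" "scaleC c a"] by simp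

lemma scaleC_diff_left: "scaleC (c - d) a = scaleC c a - scaleC d (a::'b::unital_cstar_algebra)"
  using scaleC_add_left[of c "-d" a] by (simp add: scaleC_minus_left)

lemma scaleC_minus_right: "scaleC c (- a) = - scaleC c (a::'b::unital_cstar_algebra)"
  using scaleC_scaleC[of c "-1" a] scaleR_eq_scaleC[of "-1" a] by (simp add: scaleC_minus_left)

lemma scaleC_diff_right: "scaleC c (a - b) = scaleC c a - scaleC c (b::'b::unital_cstar_algebra)"
  using scaleC_add_right[of c a "-b"] by (simp add: scaleC_minus_right)

lemma scaleC_one [simp]: "scaleC 1 a = (a::'b::unital_cstar_algebra)"
  using scaleR_eq_scaleC[of 1 a] by simp

section \<open>Invertibility in Banach and C*-algebras\<close>

definition two_sided_unit :: "'b::ring_1 \<Rightarrow> bool" where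
  "two_sided_unit a \<longleftrightarrow> (\<exists>b. a * b = 1 \<and> b * a = 1)"

text \<open>Neumann series: splitting off the first term of \<open>?S\<close> gives
  \<open>?S = 1 + x * ?S\<close> and \<open>?S = 1 + ?S * x\<close>.\<close>

lemma two_sided_unit_one_minus:
  fixes x :: "'b::{real_normed_algebra_1, banach}"
  assumes "norm x < 1"
  shows "two_sided_unit (1 - x)"
proof -
  have s: "summable (\<lambda>n. x ^ n)" using assms by (rule complete_algebra_summable_geometric)
  let ?S = "\<Sum>n. x ^ n"
  have head: "?S = 1 + (\<Sum>n. x ^ Suc n)"
    using suminf_split_head[OF s] by simp
  have "?S = 1 + x * ?S" using head suminf_mult[OF s, of x] by simp
  moreover have "?S = 1 + ?S * x"
    using head suminf_mult2[OF s, of x] by (simp add: power_commutes)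
  ultimately show ?thesis unfolding two_sided_unit_def
    by (intro exI[of _ ?S]) (simp add: algebra_simps)
qed

lemma two_sided_unit_scaleC:
  fixes a :: "'b::unital_cstar_algebra"
  assumes "c \<noteq> 0" "two_sided_unit a"
  shows "two_sided_unit (scaleC c a)"
proof -
  obtain b where "a * b = 1" "b * a = 1" using assms(2) by (auto simp: two_sided_unit_def)
  then show ?thesis using assms(1) unfolding two_sided_unit_def
    by (intro exI[of _ "scaleC (inverse c) b"])
       (simp add: mult_scaleC_left mult_scaleC_right scaleC_scaleC)
qed

lemma two_sided_unit_diff_scalar:
  fixes b :: "'b::unital_cstar_algebra"
  assumes "norm b < cmod c"
  shows "two_sided_unit (b - scaleC c 1)"
proof -
  have c: "c \<noteq> 0" using assms by force
  have "norm (scaleC (inverse c) b) < 1"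
    using assms c by (simp add: norm_scaleC norm_inverse norm_divide field_simps)
  from two_sided_unit_scaleC[OF _ two_sided_unit_one_minus[OF this], of "- c"] c
  show ?thesis by (simp add: scaleC_minus_left scaleC_diff_right scaleC_scaleC)
qed

text \<open>An inverse \<open>r\<close> of \<open>1 + a * b\<close> yields the inverse
  \<open>1 - b * r * a\<close> of \<open>1 + b * a\<close>.\<close>

lemma two_sided_unit_one_plus_commute:
  fixes a b :: "'b::ring_1"
  assumes "two_sided_unit (1 + a * b)"
  shows "two_sided_unit (1 + b * a)"
proof -
  obtain r where r: "(1 + a * b) * r = 1" "r * (1 + a * b) = 1"
    using assms by (auto simp: two_sided_unit_def)
  have 1: "a * b * r = 1 - r" using r(1) by (simp add: algebra_simps eq_diff_eq add.commute)
  have 2: "r * a * b = 1 - r" using r(2) by (simp add: algebra_simps eq_diff_eq add.commute)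
  have "(1 + b * a) * (1 - b * r * a) = 1 + b * a - b * r * a - b * (a * b * r) * a"
    by (simp add: algebra_simps)
  also have "\<dots> = 1" unfolding 1 by (simp add: algebra_simps)
  finally have A: "(1 + b * a) * (1 - b * r * a) = 1" .
  have "(1 - b * r * a) * (1 + b * a) = 1 + b * a - b * r * a - b * (r * a * b) * a"
    by (simp add: algebra_simps)
  also have "\<dots> = 1" unfolding 2 by (simp add: algebra_simps)
  finally show ?thesis using A by (auto simp: two_sided_unit_def)
qed

subsection \<open>Square roots\<close>

text \<open>A fixed point \<open>y\<close> satisfies \<open>2 y = h + y * y\<close>, so
  \<open>1 - y\<close> is a square root of \<open>1 - h\<close>.\<close>

primrec sqrt_iter :: "'b::real_normed_algebra_1 \<Rightarrow> nat \<Rightarrow> 'b" where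
  "sqrt_iter h 0 = 0"
| "sqrt_iter h (Suc n) = (1/2) *\<^sub>R (h + sqrt_iter h n * sqrt_iter h n)"

text \<open>The scalar iteration for \<^term>\<open>1::real\<close> majorises the iteration for every
  \<^term>\<open>h\<close> in the closed unit ball, so convergence holds even when \<^term>\<open>norm h = 1\<close>.\<close>
lemma sqrt_iter_majorant:
  fixes h :: "'b::real_normed_algebra_1"
  assumes "norm h \<le> 1"
  shows "norm (sqrt_iter h n) \<le> sqrt_iter (1::real) n \<and>
    norm (sqrt_iter h (Suc n) - sqrt_iter h n) \<le> sqrt_iter (1::real) (Suc n) - sqrt_iter 1 n"
proof (induction n)
  case 0
  then show ?case using assms by simp
next
  case (Suc n)
  define y where "y = sqrt_iter h n"
  define y' where "y' = sqrt_iter h (Suc n)"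
  define t where "t = sqrt_iter (1::real) n"
  define t' where "t' = sqrt_iter (1::real) (Suc n)"
  have IH: "norm y \<le> t" "norm (y' - y) \<le> t' - t" using Suc by (simp_all only: y_def y'_def t_def t'_def)
  have y': "norm y' \<le> t'" using IH norm_triangle_sub[of y' y] by linarith
  have "sqrt_iter h (Suc (Suc n)) - y' = (1/2) *\<^sub>R (y' * y' - y * y)"
    by (simp add: y_def y'_def algebra_simps)
  also have "y' * y' - y * y = (y' - y) * y' + y * (y' - y)" by (simp add: algebra_simps)
  finally have "norm (sqrt_iter h (Suc (Suc n)) - y') = (1/2) * norm ((y' - y) * y' + y * (y' - y))"
    by simp
  also have "norm ((y' - y) * y' + y * (y' - y)) \<le> (t' - t) * t' + t * (t' - t)"
    by (intro order.trans[OF norm_triangle_ineq] add_mono order.trans[OF norm_mult_ineq] mult_mono)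
       (use IH y' norm_ge_zero[of "y' - y"] norm_ge_zero[of y] norm_ge_zero[of y'] in linarith)+
  also have "(1/2) * ((t' - t) * t' + t * (t' - t)) = sqrt_iter 1 (Suc (Suc n)) - t'"
    by (simp add: t_def t'_def algebra_simps)
  finally show ?case using y' by (simp only: y'_def t'_def)
qed

lemma sqrt_iter_one_le: "sqrt_iter (1::real) n \<ge> 0 \<and> sqrt_iter (1::real) n \<le> 1"
proof (induction n)
  case (Suc n)
  then have "sqrt_iter (1::real) n * sqrt_iter 1 n \<le> 1" by (simp add: mult_le_one)
  then show ?case by simp
qed simp

lemma convergent_sqrt_iter:
  fixes h :: "'b::{real_normed_algebra_1, banach}"
  assumes "norm h \<le> 1"
  shows "convergent (sqrt_iter h)"
proof -
  have inc: "incseq (sqrt_iter (1::real))"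
  proof (rule incseq_SucI)
    fix n
    have "0 \<le> sqrt_iter (1::real) (Suc n) - sqrt_iter 1 n"
      by (rule order.trans[OF norm_ge_zero conjunct2[OF sqrt_iter_majorant[of "1::real"]]]) simp
    then show "sqrt_iter (1::real) n \<le> sqrt_iter 1 (Suc n)" by (simp only: diff_ge_0_iff_ge)
  qed
  have "convergent (sqrt_iter (1::real))"
    using sqrt_iter_one_le by (intro Bseq_mono_convergent BseqI'[of _ 1]) (use inc in \<open>auto simp: incseq_def\<close>)
  then have "summable (\<lambda>n. sqrt_iter (1::real) (Suc n) - sqrt_iter 1 n)"
    by (metis convergent_LIMSEQ_iff sums_summable telescope_sums)
  then have "summable (\<lambda>n. sqrt_iter h (Suc n) - sqrt_iter h n)"
    by (rule summable_comparison_test'[of _ 0]) (use sqrt_iter_majorant[OF assms] in auto)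
  then have "convergent (\<lambda>n. \<Sum>i<n. sqrt_iter h (Suc i) - sqrt_iter h i)"
    by (simp add: summable_iff_convergent)
  then show ?thesis by (simp only: sum_lessThan_telescope) (simp only: sqrt_iter.simps(1) diff_zero)
qed

text \<open>The root is \<open>1 - y\<close> with \<open>y\<close> the limit of the iteration.
  Self-adjointness, the norm bound and commutation with everything commuting with \<open>h\<close>
  hold for each iterate and pass to the limit.\<close>

lemma exists_sqrt_one_minus:
  fixes h :: "'b::unital_cstar_algebra"
  assumes h: "star h = h" "norm h \<le> 1"
  obtains g where "star g = g" "g * g = 1 - h" "norm (1 - g) \<le> 1"
    "\<And>b. b * h = h * b \<Longrightarrow> b * g = g * b"
proof -
  obtain y where y: "sqrt_iter h \<longlonglongrightarrow> y"
    using convergent_sqrt_iter[OF h(2)] by (auto simp: convergent_def)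
  have "(\<lambda>n. sqrt_iter h (Suc n)) \<longlonglongrightarrow> (1/2) *\<^sub>R (h + y * y)"
    unfolding sqrt_iter.simps by (intro tendsto_intros y)
  then have "y = (1/2) *\<^sub>R (h + y * y)"
    using LIMSEQ_unique LIMSEQ_Suc[OF y] by blast
  then have eq: "y + y = h + y * y"
    by (metis scaleR_half_double scaleR_right_distrib)
  have "star (sqrt_iter h n) = sqrt_iter h n" for n
    by (induction n) (simp_all add: star_add star_mult h)
  then have sy: "star y = y"
    by (intro LIMSEQ_unique[OF _ y]) (use bounded_linear.tendsto[OF bounded_linear_star y] in simp)
  have ny: "norm y \<le> 1"
    using sqrt_iter_majorant[OF h(2)] sqrt_iter_one_le
    by (intro LIMSEQ_le_const2[OF tendsto_norm[OF y]]) (meson order.trans)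
  have com: "b * y = y * b" if b: "b * h = h * b" for b
  proof -
    have "b * sqrt_iter h n = sqrt_iter h n * b" for n
    proof (induction n)
      case (Suc n)
      then have "b * (sqrt_iter h n * sqrt_iter h n) = sqrt_iter h n * sqrt_iter h n * b"
        by (metis mult.assoc)
      then show ?case using b by (simp add: distrib_left distrib_right)
    qed simp
    then show ?thesis
      using tendsto_mult[OF tendsto_const[of b] y] tendsto_mult[OF y tendsto_const[of b]] LIMSEQ_unique
      by auto
  qed
  show ?thesis
  proof (rule that[of "1 - y"])
    have "(1 - y) * (1 - y) = 1 - (y + y) + y * y" by (simp add: algebra_simps)
    then show "(1 - y) * (1 - y) = 1 - h" unfolding eq by simp
  qed (use sy ny com in \<open>auto simp: algebra_simps\<close>)
qed

subsection \<open>The positive cone\<close>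

text \<open>A norm characterisation of positivity, under which sums of positive elements are visibly
  positive and which needs no spectral radius formula.\<close>
definition cstar_nonneg :: "'b::unital_cstar_algebra \<Rightarrow> bool" where
  "cstar_nonneg a \<longleftrightarrow> star a = a \<and> (\<exists>s\<ge>0. norm (s *\<^sub>R 1 - a) \<le> s)"

text \<open>Allows the radius in \<open>cstar_nonneg\<close> to be enlarged.\<close>

lemma norm_scalar_diff_mono:
  fixes a :: "'b::real_normed_algebra_1"
  assumes "norm (s *\<^sub>R 1 - a) \<le> s" "s \<le> t"
  shows "norm (t *\<^sub>R 1 - a) \<le> t"
proof -
  have "t *\<^sub>R 1 - a = (t - s) *\<^sub>R 1 + (s *\<^sub>R 1 - a)" by (simp add: algebra_simps)
  then have "norm (t *\<^sub>R 1 - a) \<le> norm ((t - s) *\<^sub>R (1::'b)) + norm (s *\<^sub>R 1 - a)"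
    by (metis norm_triangle_ineq)
  then show ?thesis using assms by simp
qed

lemma cstar_nonneg_star: "cstar_nonneg a \<Longrightarrow> star a = a"
  by (simp add: cstar_nonneg_def)

lemma cstar_nonneg_0 [simp]: "cstar_nonneg 0"
  by (auto simp: cstar_nonneg_def)

lemma cstar_nonneg_add:
  assumes "cstar_nonneg a" "cstar_nonneg b"
  shows "cstar_nonneg (a + b)"
proof -
  obtain s t where "s \<ge> 0" "norm (s *\<^sub>R 1 - a) \<le> s" "t \<ge> 0" "norm (t *\<^sub>R 1 - b) \<le> t"
    using assms by (auto simp: cstar_nonneg_def)
  moreover have "(s + t) *\<^sub>R 1 - (a + b) = (s *\<^sub>R 1 - a) + (t *\<^sub>R 1 - b)"
    by (simp add: algebra_simps)
  then have "norm ((s + t) *\<^sub>R 1 - (a + b)) \<le> norm (s *\<^sub>R 1 - a) + norm (t *\<^sub>R 1 - b)"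
    by (metis norm_triangle_ineq)
  ultimately show ?thesis using assms unfolding cstar_nonneg_def
    by (intro conjI exI[of _ "s + t"]) (auto simp: star_add)
qed

lemma cstar_nonneg_sum: "(\<And>i. i \<in> A \<Longrightarrow> cstar_nonneg (f i)) \<Longrightarrow> cstar_nonneg (sum f A)"
  by (induction A rule: infinite_finite_induct) (auto intro: cstar_nonneg_add)

lemma cstar_nonneg_scaleR:
  assumes "cstar_nonneg a" "r \<ge> 0"
  shows "cstar_nonneg (r *\<^sub>R a)"
proof -
  obtain s where s: "s \<ge> 0" "norm (s *\<^sub>R 1 - a) \<le> s" using assms by (auto simp: cstar_nonneg_def)
  have "norm ((r * s) *\<^sub>R 1 - r *\<^sub>R a) = r * norm (s *\<^sub>R 1 - a)"
    using assms(2) by (metis abs_of_nonneg norm_scaleR scaleR_right_diff_distrib scaleR_scaleR)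
  also have "\<dots> \<le> r * s" using assms s by (intro mult_left_mono) auto
  finally show ?thesis using assms s unfolding cstar_nonneg_def
    by (intro conjI exI[of _ "r * s"]) auto
qed

lemma cstar_nonneg_scalar_diff:
  assumes "star x = x" "norm x \<le> t"
  shows "cstar_nonneg (t *\<^sub>R 1 - x)"
  using assms order.trans[OF norm_ge_zero assms(2)] unfolding cstar_nonneg_def
  by (intro conjI exI[of _ t]) auto

text \<open>For \<open>u = g + i f\<close> one has \<open>star u * u = t\<close>, so the C*-identity
  gives \<open>norm u = sqrt t\<close>, and \<open>g\<close> is the real part of \<open>u\<close>.
  This replaces functional calculus for the commuting pair.\<close>

lemma norm_le_of_sum_squares:
  fixes f g :: "'b::unital_cstar_algebra"
  assumes "star f = f" "star g = g" "f * g = g * f" "f * f + g * g = t *\<^sub>R 1" "t \<ge> 0"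
  shows "norm (g * g) \<le> t"
proof -
  define u where "u = g + scaleC \<i> f"
  have su: "star u = g - scaleC \<i> f"
    using assms by (simp add: u_def star_add star_scaleC scaleC_minus_left)
  have "star u * u = t *\<^sub>R 1"
    unfolding su using assms(3,4)
    by (simp add: u_def algebra_simps mult_scaleC_left mult_scaleC_right scaleC_scaleC
        scaleC_minus_left scaleC_diff_right scaleC_add_right)
  then have nu: "(norm u)\<^sup>2 = t" using norm_star_mult[of u] assms(5) by simp
  have "u + star u = g + g" by (simp add: su) (simp add: u_def)
  then have "2 *\<^sub>R g = u + star u" by (simp add: scaleR_2)
  then have "2 * norm g = norm (u + star u)" by (metis abs_numeral norm_scaleR)
  also have "\<dots> \<le> 2 * norm u" using norm_triangle_ineq[of u "star u"] by simp
  finally have "(norm g)\<^sup>2 \<le> t" unfolding nu[symmetric] by (intro power_mono) auto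
  then show ?thesis using norm_star_mult[of g] assms(2) by simp
qed

text \<open>After scaling to norm 1, let \<open>g\<close> be a root of \<open>1 - k * k\<close>. The
  two squares add to 1, so \<open>norm (g * g) <= 1\<close>, which places
  \<open>k * k = 1 - g * g\<close> in the cone.\<close>

lemma cstar_nonneg_square:
  assumes "star h = h"
  shows "cstar_nonneg (h * h)"
proof (cases "h = 0")
  case False
  define k where "k = (1 / norm h) *\<^sub>R h"
  have k: "star k = k" "norm k = 1" using assms False by (auto simp: k_def)
  have "norm (k * k) \<le> 1" using norm_mult_ineq[of k k] k by simp
  moreover have "star (k * k) = k * k" using k by (simp add: star_mult)
  ultimately obtain g where g: "star g = g" "g * g = 1 - k * k" "norm (1 - g) \<le> 1"
      "\<And>b. b * (k * k) = (k * k) * b \<Longrightarrow> b * g = g * b"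
    using exists_sqrt_one_minus by blast
  have "k * g = g * k" by (rule g(4)) (simp add: mult.assoc)
  then have "norm (g * g) \<le> 1"
    using norm_le_of_sum_squares[of k g 1] g(1,2) k by simp
  then have "cstar_nonneg (k * k)"
    using cstar_nonneg_scalar_diff[of "g * g" 1] g(1,2) k(1) by (simp add: star_mult)
  from cstar_nonneg_scaleR[OF this, of "(norm h)\<^sup>2"] show ?thesis
    using False by (simp add: k_def power2_eq_square)
qed simp

text \<open>The element \<open>h = 1 - a / s\<close> has norm at most 1 by the definition of the
  cone; a root of \<open>1 - h\<close> is rescaled by \<open>sqrt s\<close>. The radius is first
  enlarged so that it can be divided by.\<close>

lemma cstar_nonneg_sqrt:
  assumes "cstar_nonneg a"
  obtains g where "cstar_nonneg g" "g * g = a" "\<And>b. b * a = a * b \<Longrightarrow> b * g = g * b"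
proof -
  obtain s0 where "s0 \<ge> 0" "norm (s0 *\<^sub>R 1 - a) \<le> s0"
    using assms by (auto simp: cstar_nonneg_def)
  then obtain s where s: "s > 0" "norm (s *\<^sub>R 1 - a) \<le> s"
    using norm_scalar_diff_mono[of s0 a "s0 + 1"]
    by (metis add.commute add_pos_nonneg le_add_same_cancel2 zero_le_one zero_less_one)
  define h where "h = 1 - (1 / s) *\<^sub>R a"
  have "s *\<^sub>R h = s *\<^sub>R 1 - a" using s by (simp add: h_def algebra_simps)
  then have "s * norm h \<le> s" using s by (metis abs_of_pos norm_scaleR)
  then have "norm h \<le> 1" using s by simp
  moreover have "star h = h" using assms by (simp add: h_def cstar_nonneg_star)
  ultimately obtain g where g: "star g = g" "g * g = 1 - h" "norm (1 - g) \<le> 1"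
      "\<And>b. b * h = h * b \<Longrightarrow> b * g = g * b"
    using exists_sqrt_one_minus by blast
  show ?thesis
  proof (rule that[of "sqrt s *\<^sub>R g"])
    show "cstar_nonneg (sqrt s *\<^sub>R g)"
      using g(1,3) s by (intro cstar_nonneg_scaleR) (auto simp: cstar_nonneg_def intro!: exI[of _ 1])
    show "(sqrt s *\<^sub>R g) * (sqrt s *\<^sub>R g) = a" using g(2) s by (simp add: h_def)
    show "b * (sqrt s *\<^sub>R g) = (sqrt s *\<^sub>R g) * b" if "b * a = a * b" for b
      using g(4)[of b] that by (simp add: h_def algebra_simps)
  qed
qed

text \<open>The roots \<open>g\<close> of \<open>x\<close> and \<open>f\<close> of
  \<open>t - x\<close> commute, because each commutes with whatever its square commutes with, and
  their squares add to \<open>t\<close>.\<close>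

lemma norm_le_of_cstar_nonneg:
  assumes "cstar_nonneg x" "cstar_nonneg (t *\<^sub>R 1 - x)" "t \<ge> 0"
  shows "norm x \<le> t"
proof -
  obtain g where g: "cstar_nonneg g" "g * g = x" "\<And>b. b * x = x * b \<Longrightarrow> b * g = g * b"
    using cstar_nonneg_sqrt[OF assms(1)] by blast
  obtain f where f: "cstar_nonneg f" "f * f = t *\<^sub>R 1 - x"
      "\<And>b. b * (t *\<^sub>R 1 - x) = (t *\<^sub>R 1 - x) * b \<Longrightarrow> b * f = f * b"
    using cstar_nonneg_sqrt[OF assms(2)] by blast
  have "x * f = f * x" by (rule f(3)) (simp add: algebra_simps)
  then have "f * x = x * f" by simp
  then have "f * g = g * f" by (rule g(3))
  then have "norm (g * g) \<le> t"
    using f(1,2) g(1,2) assms(3) by (intro norm_le_of_sum_squares[of f]) (auto simp: cstar_nonneg_star)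
  then show ?thesis using g(2) by simp
qed

text \<open>\<open>norm y - x\<close> is the sum of the nonnegative elements
  \<open>norm y - y\<close> and \<open>y - x\<close>.\<close>

lemma norm_mono_cstar_nonneg:
  assumes "cstar_nonneg x" "cstar_nonneg (y - x)"
  shows "norm x \<le> norm y"
proof -
  have "star (y - x + x) = y - x + x"
    using assms by (intro cstar_nonneg_star cstar_nonneg_add)
  then have "star y = y" by simp
  then have "cstar_nonneg ((norm y *\<^sub>R 1 - y) + (y - x))"
    by (intro cstar_nonneg_add assms cstar_nonneg_scalar_diff) simp_all
  then have "cstar_nonneg (norm y *\<^sub>R 1 - x)" by simp
  from norm_le_of_cstar_nonneg[OF assms(1) this norm_ge_zero] show ?thesis .
qed

lemma cstar_nonneg_antisym:
  assumes "cstar_nonneg a" "cstar_nonneg (- a)"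
  shows "a = 0"
  using norm_mono_cstar_nonneg[OF assms(1), of 0] assms(2) by simp

text \<open>For \<open>z\<close> in the spectrum the disc bound with \<open>s' = s\<close> reads
  \<open>|z|^2 <= 2 s Re z + 2 t Im z\<close> for all real \<open>t\<close>. Hence
  \<open>Im z = 0\<close>, and then \<open>Re z >= 0\<close>.\<close>

lemma cstar_nonneg_imp_positive:
  assumes "cstar_nonneg a"
  shows "positive a"
proof -
  have "\<exists>r\<ge>0. z = complex_of_real r" if z: "z \<in> spectrum a" for z
  proof -
    obtain s where s: "s \<ge> 0" "norm (s *\<^sub>R 1 - a) \<le> s" using assms by (auto simp: cstar_nonneg_def)
    \<comment> \<open>Every disc with centre \<open>s' + i t\<close>, \<open>s' \<ge> s\<close>, and boundary through 0 contains the spectrum.\<close>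
    have disc: "(Re z - s')\<^sup>2 + (Im z - t)\<^sup>2 \<le> s'\<^sup>2 + t\<^sup>2" if s': "s' \<ge> s" for s' t
    proof (rule ccontr)
      assume less: "\<not> ?thesis"
      define w where "w = Complex s' t"
      define u where "u = a - scaleC w 1"
      define d where "d = s' *\<^sub>R 1 - a"
      have w: "w = complex_of_real s' + complex_of_real t * \<i>" by (simp add: w_def complex_eq_iff)
      have u: "u = - d - scaleC (complex_of_real t * \<i>) 1"
        by (simp add: u_def d_def w scaleC_add_left scaleR_eq_scaleC)
      have sd: "star d = d" using assms by (simp add: d_def cstar_nonneg_star)
      have it: "\<i> * (complex_of_real t * (\<i> * complex_of_real t)) = - complex_of_real (t * t)"
        by (simp add: algebra_simps)
      have "star u * u = d * d + t\<^sup>2 *\<^sub>R 1"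
        unfolding u using sd
        by (simp add: star_scaleC scaleC_minus_left algebra_simps mult_scaleC_left mult_scaleC_right
            scaleC_scaleC scaleR_eq_scaleC power2_eq_square scaleC_diff_right it)
      then have "(norm u)\<^sup>2 \<le> norm (d * d) + t\<^sup>2"
        using norm_star_mult[of u] norm_triangle_ineq[of "d * d" "t\<^sup>2 *\<^sub>R 1"] by simp
      also have "norm (d * d) = (norm d)\<^sup>2" using norm_star_mult[of d] sd by simp
      also have "\<dots> \<le> s'\<^sup>2"
        using norm_scalar_diff_mono[OF s(2) s'] by (intro power_mono) (auto simp: d_def)
      also have "s'\<^sup>2 + t\<^sup>2 < (cmod (z - w))\<^sup>2" using less by (simp add: w_def cmod_power2)
      finally have "norm u < cmod (z - w)" using power2_less_imp_less by force
      from two_sided_unit_diff_scalar[OF this] have "two_sided_unit (a - scaleC z 1)"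
        by (simp add: u_def scaleC_diff_left)
      then show False using z by (auto simp: spectrum_def two_sided_unit_def)
    qed
    have "Im z = 0"
    proof (rule ccontr)
      assume ne: "Im z \<noteq> 0"
      \<comment> \<open>With this \<open>t\<close> the disc bound becomes
        \<open>(Re z - s)^2 + (Im z)^2 <= -1\<close>.\<close>
      define t where "t = - (s\<^sup>2 + 1) / (2 * Im z)"
      have "2 * t * Im z = - (s\<^sup>2 + 1)" using ne by (simp add: t_def)
      then have "(Re z - s)\<^sup>2 + (Im z)\<^sup>2 \<le> - 1"
        using disc[of s t] by (simp add: power2_diff[of "Im z"] algebra_simps)
      then show False using sum_power2_ge_zero[of "Re z - s" "Im z"] by linarith
    qed
    moreover have "Re z \<ge> 0"
    proof (rule ccontr)
      assume "\<not> ?thesis"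
      then have "(Re z - s)\<^sup>2 > s\<^sup>2" using s(1)
        by (intro power_strict_mono[of s "s - Re z" 2, unfolded power2_commute[of s]]) auto
      then show False using disc[of s 0] zero_le_power2[of "Im z"] by auto
    qed
    ultimately show ?thesis by (intro exI[of _ "Re z"]) (simp add: complex_eq_iff)
  qed
  then show ?thesis using assms by (simp add: positive_def cstar_nonneg_star)
qed

section \<open>Invertible shifts of nonnegative elements\<close>

lemma two_sided_unit_cstar_nonneg:
  assumes "cstar_nonneg a" "t > 0"
  shows "two_sided_unit (a + t *\<^sub>R 1)"
proof -
  have "complex_of_real (- t) \<notin> spectrum a"
    using cstar_nonneg_imp_positive[OF assms(1)] assms(2)
    by (metis leD neg_0_le_iff_le of_real_eq_iff positive_def)
  then show ?thesis by (simp add: spectrum_def two_sided_unit_def scaleR_eq_scaleC scaleC_minus_left)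
qed

text \<open>With \<open>t = norm x\<close>, an inverse \<open>r\<close> of \<open>t - x\<close>
  would keep \<open>t - x\<close> above some \<open>e > 0\<close>, forcing
  \<open>norm x <= t - e\<close>. So the norm lies in the spectrum.\<close>

lemma not_two_sided_unit_norm_diff:
  assumes "cstar_nonneg x" "x \<noteq> 0"
  shows "\<not> two_sided_unit (norm x *\<^sub>R 1 - x)"
proof
  define t where "t = norm x"
  assume "two_sided_unit (norm x *\<^sub>R 1 - x)"
  then obtain r where r: "(t *\<^sub>R 1 - x) * r = 1" "r * (t *\<^sub>R 1 - x) = 1"
    by (auto simp: two_sided_unit_def t_def)
  have "cstar_nonneg (t *\<^sub>R 1 - x)"
    using assms by (intro cstar_nonneg_scalar_diff) (auto simp: cstar_nonneg_star t_def)
  then obtain f where f: "cstar_nonneg f" "f * f = t *\<^sub>R 1 - x"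
    using cstar_nonneg_sqrt by blast
  have ffr: "f * f * r = 1" "r * (f * f) = 1" using r f by simp_all
  have "r * f = r * f * (f * f * r)" using ffr by simp
  also have "\<dots> = (r * (f * f)) * (f * r)" by (simp add: mult.assoc)
  finally have rf: "r * f = f * r" using ffr by simp
  have sf: "star f = f" using f by (simp add: cstar_nonneg_star)
  have "star r * (f * f) = 1" using arg_cong[OF ffr(1), of star] by (simp add: star_mult sf mult.assoc)
  then have sr: "star r = r" using ffr by (metis mult.assoc mult_1_left mult_1_right)
  have r0: "norm r > 0" using r by force
  have t0: "t > 0" using assms by (simp add: t_def)
  \<comment> \<open>\<open>e <= 1 / norm r\<close> makes \<open>1 - e r\<close> nonnegative, and
    \<open>e <= t\<close> keeps the bound \<open>t - e\<close> nonnegative.\<close>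
  define e where "e = min t (1 / norm r)"
  have e: "e > 0" "e \<le> t" "e * norm r \<le> 1" using r0 t0 by (auto simp: e_def min_def field_simps)
  have "cstar_nonneg (1 *\<^sub>R 1 - e *\<^sub>R r)"
    using e sr by (intro cstar_nonneg_scalar_diff) auto
  then obtain g where g: "cstar_nonneg g" "g * g = 1 *\<^sub>R 1 - e *\<^sub>R r"
      "\<And>b. b * (1 *\<^sub>R 1 - e *\<^sub>R r) = (1 *\<^sub>R 1 - e *\<^sub>R r) * b \<Longrightarrow> b * g = g * b"
    using cstar_nonneg_sqrt by blast
  have fg: "f * g = g * f" using rf by (intro g(3)) (simp add: algebra_simps)
  \<comment> \<open>The product of \<open>t - x\<close> and \<open>1 - e r\<close> is
    \<open>t - e - x\<close>, exhibited here as the square of the self-adjoint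
    \<open>f * g\<close>.\<close>
  have "(f * g) * (f * g) = f * f * (g * g)" by (metis fg mult.assoc)
  also have "\<dots> = (t - e) *\<^sub>R 1 - x" using ffr by (simp add: g(2) f(2) algebra_simps)
  finally have "cstar_nonneg ((t - e) *\<^sub>R 1 - x)"
    using cstar_nonneg_square[of "f * g"] fg g(1) f by (simp add: star_mult cstar_nonneg_star)
  then have "norm x \<le> t - e" using assms e by (intro norm_le_of_cstar_nonneg) auto
  then show False using e by (simp add: t_def)
qed

text \<open>Writing \<open>c = x + i y\<close> gives
  \<open>c * star c = 2 x^2 + 2 y^2 - star c * c\<close>, so \<open>c * star c\<close> is
  nonnegative. If \<open>p = - (star c * c)\<close> were nonzero and \<open>t = norm p\<close>, then
  \<open>1 + c * star c / t\<close> would be invertible; swapping the factors makes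
  \<open>t - p\<close> invertible, which is impossible.\<close>

lemma eq_0_if_cstar_nonneg_minus:
  assumes "cstar_nonneg (- (star c * c))"
  shows "c = 0"
proof -
  define x where "x = (1/2) *\<^sub>R (c + star c)"
  define y where "y = scaleC (- \<i> / 2) (c - star c)"
  define p where "p = - (star c * c)"
  have x: "star x = x" by (simp add: x_def star_add star_star add.commute)
  have y: "star y = y"
    by (simp add: y_def star_scaleC star_star scaleC_minus_left scaleC_diff_right)
  have "4 *\<^sub>R (x * x) = (c + star c) * (c + star c)" by (simp add: x_def)
  moreover have "4 *\<^sub>R (y * y) = - ((c - star c) * (c - star c))"
    by (simp add: y_def mult_scaleC_left mult_scaleC_right scaleC_scaleC scaleR_eq_scaleC
        scaleC_minus_left scaleC_minus_right)
  ultimately have "4 *\<^sub>R (x * x) + 4 *\<^sub>R (y * y) = 2 *\<^sub>R (c * star c + star c * c)"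
    by (simp add: algebra_simps scaleR_2)
  then have "2 *\<^sub>R (c * star c) = 4 *\<^sub>R (x * x) + 4 *\<^sub>R (y * y) + 2 *\<^sub>R p"
    by (simp add: p_def algebra_simps)
  then have "c * star c = (1/2) *\<^sub>R (4 *\<^sub>R (x * x) + 4 *\<^sub>R (y * y) + 2 *\<^sub>R p)"
    by (metis scaleR_half_double scaleR_2)
  also have "cstar_nonneg \<dots>"
    using assms x y unfolding p_def
    by (intro cstar_nonneg_scaleR cstar_nonneg_add cstar_nonneg_square) auto
  finally have cc: "cstar_nonneg (c * star c)" .
  have "p = 0"
  proof (rule ccontr)
    assume p0: "p \<noteq> 0"
    define t where "t = norm p"
    have t: "t > 0" using p0 by (simp add: t_def)
    have "cstar_nonneg ((1/t) *\<^sub>R (c * star c))" using cc t by (intro cstar_nonneg_scaleR) auto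
    from two_sided_unit_cstar_nonneg[OF this zero_less_one]
    have "two_sided_unit (1 + ((1/t) *\<^sub>R c) * star c)" by (simp add: add.commute)
    from two_sided_unit_one_plus_commute[OF this]
    have "two_sided_unit (1 + (1/t) *\<^sub>R (star c * c))" by simp
    from two_sided_unit_scaleC[OF _ this, of "complex_of_real t"]
    have "two_sided_unit (t *\<^sub>R 1 + star c * c)"
      using t by (simp add: scaleR_eq_scaleC[symmetric] scaleR_add_right)
    then show False using not_two_sided_unit_norm_diff[of p] assms p0 by (simp add: p_def t_def)
  qed
  then show ?thesis using norm_star_mult[of c] by (simp add: p_def)
qed

text \<open>Kaplansky's argument: with \<open>h = a\<^sup>* a\<close> and \<open>v = |h| - h\<close>, the element \<open>c = a v\<close>
  satisfies \<open>c\<^sup>* c = - |h| v\<^sup>2 \<le> 0\<close>, which forces \<open>c = 0\<close> and then \<open>v = 0\<close>.\<close>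
lemma cstar_nonneg_star_mult: "cstar_nonneg (star a * a)"
proof -
  define h where "h = star a * a"
  have h: "star h = h" by (simp add: h_def star_mult star_star)
  obtain m where m: "cstar_nonneg m" "m * m = h * h" "\<And>b. b * (h * h) = (h * h) * b \<Longrightarrow> b * m = m * b"
    using cstar_nonneg_sqrt[OF cstar_nonneg_square[OF h]] by blast
  obtain r where r: "cstar_nonneg r" "r * r = m" "\<And>b. b * m = m * b \<Longrightarrow> b * r = r * b"
    using cstar_nonneg_sqrt[OF m(1)] by blast
  define v where "v = m - h"
  have hm: "h * m = m * h" by (rule m(3)) (simp add: mult.assoc)
  have vh: "v * h = - (m * v)" using hm m(2) by (simp add: v_def algebra_simps)
  have sv: "star v = v" using h m(1) by (simp add: v_def cstar_nonneg_star)
  have rv: "v * r = r * v" using hm by (intro r(3)) (simp add: v_def algebra_simps)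
  have "star (a * v) * (a * v) = v * h * v" by (simp add: star_mult sv h_def mult.assoc)
  also have "\<dots> = - (m * v * v)" by (simp add: vh)
  also have "m * v * v = (r * v) * (r * v)" unfolding r(2)[symmetric] by (metis rv mult.assoc)
  finally have "cstar_nonneg (- (star (a * v) * (a * v)))"
    using cstar_nonneg_square[of "r * v"] rv sv r(1) by (simp add: star_mult cstar_nonneg_star)
  then have "a * v = 0" by (rule eq_0_if_cstar_nonneg_minus)
  then have hv: "h * v = 0" by (simp add: h_def mult.assoc)
  have "v * h = h * v" using hm by (simp add: v_def algebra_simps)
  then have "m * v = 0" using vh hv by simp
  then have "v * v = 0" using hv by (simp add: v_def left_diff_distrib)
  then have "v = 0" using norm_star_mult[of v] sv by simp
  then show ?thesis using m(1) by (simp add: v_def h_def)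
qed

lemma cstar_nonneg_mult_star: "cstar_nonneg (a * star a)"
  using cstar_nonneg_star_mult[of "star a"] by (simp add: star_star)

lemma norm_mult_star: "norm (a * star a) = (norm a)\<^sup>2"
  using norm_star_mult[of "star a"] by (simp add: star_star)

text \<open>The remaining summands are nonnegative. This bounds single coordinates by the norm of a
  vector.\<close>

lemma norm_square_le_sum_mult_star:
  assumes "finite A" "i \<in> A"
  shows "(norm (f i))\<^sup>2 \<le> norm (\<Sum>i\<in>A. f i * star (f i))"
proof -
  have "norm (f i * star (f i)) \<le> norm (\<Sum>i\<in>A. f i * star (f i))"
    using assms by (intro norm_mono_cstar_nonneg)
      (auto simp: sum.remove[OF assms] intro!: cstar_nonneg_mult_star cstar_nonneg_sum)
  then show ?thesis by (simp add: norm_mult_star)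
qed

section \<open>Projections in matrix algebras\<close>

text \<open>The induction passes to the Schur complement of the last diagonal entry.\<close>
lemma positive_definite_row_solvable:
  fixes T :: "nat \<Rightarrow> nat \<Rightarrow> 'b::unital_cstar_algebra"
  assumes "\<And>v. cstar_nonneg
    ((\<Sum>j<k. (\<Sum>i<k. v i * T i j) * star (v j)) - (\<Sum>j<k. v j * star (v j)))"
  shows "\<exists>v. \<forall>j<k. (\<Sum>i<k. v i * T i j) = w j"
  using assms
proof (induction k arbitrary: T w)
  case (Suc k)
  have "cstar_nonneg (T k k - 1)"
    using Suc.prems[of "\<lambda>i. if i = k then 1 else 0"] by (simp add: if_distrib[of star] if_distribR)
  from two_sided_unit_cstar_nonneg[OF this zero_less_one]
  obtain r where r: "T k k * r = 1" "r * T k k = 1" by (auto simp: two_sided_unit_def)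
  define S where "S = (\<lambda>i j. T i j - T i k * r * T k j)"
  have S: "(\<Sum>i<k. v i * S i j) = (\<Sum>i<k. v i * T i j) - (\<Sum>i<k. v i * T i k) * r * T k j" for v j
    by (simp add: S_def right_diff_distrib sum_subtractf sum_distrib_right mult.assoc)
  have "cstar_nonneg ((\<Sum>j<k. (\<Sum>i<k. v i * S i j) * star (v j)) - (\<Sum>j<k. v j * star (v j)))" for v
  proof -
    \<comment> \<open>This last coordinate makes entry \<open>k\<close> of the row
      \<open>v' T\<close> vanish, so the form of \<open>T\<close> at \<open>v'\<close> is that of
      \<open>S\<close> at \<open>v\<close> minus \<open>b * star b\<close>.\<close>
    define b where "b = - (\<Sum>i<k. v i * T i k) * r"
    define v' where "v' = (\<lambda>i. if i = k then b else v i)"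
    have sum_v': "(\<Sum>i<k. v' i * T i j) = (\<Sum>i<k. v i * T i j)" for j
      by (rule sum.cong) (auto simp: v'_def)
    have row: "(\<Sum>i<Suc k. v' i * T i j) = (\<Sum>i<k. v i * S i j)" for j
      using S[of v j] sum_v'[of j] by (simp add: v'_def b_def)
    have last: "(\<Sum>i<k. v i * S i k) = 0" unfolding S using r by (simp add: mult.assoc)
    have "(\<Sum>j<Suc k. (\<Sum>i<Suc k. v' i * T i j) * star (v' j)) - (\<Sum>j<Suc k. v' j * star (v' j)) =
      (\<Sum>j<k. (\<Sum>i<k. v i * S i j) * star (v' j)) - (\<Sum>j<k. v' j * star (v' j)) - b * star b"
      unfolding row by (simp add: last) (simp add: v'_def)
    also have "\<dots> = (\<Sum>j<k. (\<Sum>i<k. v i * S i j) * star (v j)) - (\<Sum>j<k. v j * star (v j)) - b * star b"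
      by (intro arg_cong2[of _ _ _ _ minus] sum.cong) (auto simp: v'_def)
    finally show ?thesis
      using cstar_nonneg_add[OF Suc.prems[of v'] cstar_nonneg_mult_star[of b]] by simp
  qed
  from Suc.IH[OF this, of "\<lambda>j. w j - w k * r * T k j"]
  obtain u where u: "\<And>j. j < k \<Longrightarrow> (\<Sum>i<k. u i * S i j) = w j - w k * r * T k j" by blast
  \<comment> \<open>Back substitution: the last coordinate is chosen to solve equation
    \<open>k\<close>.\<close>
  define v where "v = (\<lambda>i. if i = k then (w k - (\<Sum>i<k. u i * T i k)) * r else u i)"
  have "(\<Sum>i<Suc k. v i * T i j) = w j" if "j < Suc k" for j
  proof -
    have "(\<Sum>i<k. v i * T i j) = (\<Sum>i<k. u i * T i j)"
      by (rule sum.cong) (auto simp: v_def)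
    then have eq: "(\<Sum>i<Suc k. v i * T i j)
        = (\<Sum>i<k. u i * T i j) + (w k - (\<Sum>i<k. u i * T i k)) * r * T k j"
      by (simp add: v_def)
    show ?thesis
    proof (cases "j = k")
      case True
      then show ?thesis unfolding eq using r by (simp add: mult.assoc)
    next
      case False
      then show ?thesis unfolding eq using u[of j] that S[of u j] by (simp add: left_diff_distrib algebra_simps)
    qed
  qed
  then show ?case by blast
qed simp

text \<open>Matrices are functions on all index pairs; with sums running over \<open>l < k\<close> only, the ring laws
  except those of the unit hold without any bounds on the outer indices.\<close>
definition mat_times :: "nat \<Rightarrow> (nat \<Rightarrow> nat \<Rightarrow> 'b::ring) \<Rightarrow> (nat \<Rightarrow> nat \<Rightarrow> 'b) \<Rightarrow> nat \<Rightarrow> nat \<Rightarrow> 'b" where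
  "mat_times k A B = (\<lambda>i j. \<Sum>l<k. A i l * B l j)"

definition adjoint_mat :: "(nat \<Rightarrow> nat \<Rightarrow> 'b::unital_cstar_algebra) \<Rightarrow> nat \<Rightarrow> nat \<Rightarrow> 'b" where
  "adjoint_mat A = (\<lambda>i j. star (A j i))"

text \<open>Entries outside the block are forced to 0, so equalities of \<open>k\<close> by
  \<open>k\<close> matrices become equalities of functions.\<close>

definition supported_mat :: "nat \<Rightarrow> (nat \<Rightarrow> nat \<Rightarrow> 'b::zero) \<Rightarrow> bool" where
  "supported_mat k A \<longleftrightarrow> (\<forall>i j. k \<le> i \<or> k \<le> j \<longrightarrow> A i j = 0)"

lemma mat_times_assoc: "mat_times k (mat_times k A B) C = mat_times k A (mat_times k B C)"
proof (intro ext)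
  fix i j
  have "(\<Sum>l<k. (\<Sum>m<k. A i m * B m l) * C l j) = (\<Sum>l<k. \<Sum>m<k. A i m * (B m l * C l j))"
    by (simp add: sum_distrib_right mult.assoc)
  also have "\<dots> = (\<Sum>m<k. \<Sum>l<k. A i m * (B m l * C l j))" by (rule sum.swap)
  finally show "mat_times k (mat_times k A B) C i j = mat_times k A (mat_times k B C) i j"
    by (simp add: mat_times_def sum_distrib_left)
qed

lemma mat_times_distrib:
  "mat_times k (A + B) C = mat_times k A C + mat_times k B C"
  "mat_times k (A - B) C = mat_times k A C - mat_times k B C"
  "mat_times k A (B + C) = mat_times k A B + mat_times k A C"
  "mat_times k A (B - C) = mat_times k A B - mat_times k A C"
  by (auto simp: mat_times_def fun_eq_iff sum.distrib sum_subtractf algebra_simps)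

lemma adjoint_mat_simps [simp]:
  "adjoint_mat (A + B) = adjoint_mat A + adjoint_mat B"
  "adjoint_mat (A - B) = adjoint_mat A - adjoint_mat B"
  "adjoint_mat (adjoint_mat A) = A"
  "adjoint_mat 0 = 0"
  "adjoint_mat (mat_times k A B) = mat_times k (adjoint_mat B) (adjoint_mat A)"
  by (auto simp: mat_times_def adjoint_mat_def fun_eq_iff star_add star_star star_sum star_mult)

lemma supported_mat_intros:
  "supported_mat k A \<Longrightarrow> supported_mat k B \<Longrightarrow> supported_mat k (A + B)"
  "supported_mat k A \<Longrightarrow> supported_mat k B \<Longrightarrow> supported_mat k (A - B)"
  "supported_mat k A \<Longrightarrow> supported_mat k B \<Longrightarrow> supported_mat k (mat_times k A B)"
  for A B :: "nat \<Rightarrow> nat \<Rightarrow> 'b::ring"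
  by (auto simp: supported_mat_def mat_times_def intro!: sum.neutral)

lemma supported_mat_adjoint: "supported_mat k A \<Longrightarrow> supported_mat k (adjoint_mat A)"
  by (auto simp: supported_mat_def adjoint_mat_def)

text \<open>Right multiplication by the adjoint of \<open>A\<close> leaves two matrices, each of the
  form \<open>B\<close> times its adjoint, with sum 0. Their diagonals are nonnegative, so both
  vanish. This cancellation of \<open>1 + a a^*\<close> stands in for its inverse.\<close>

lemma eq_0_if_add_mat_times_star:
  assumes "supported_mat k A"
    and "A + mat_times k A (mat_times k a (adjoint_mat a)) = 0"
  shows "A = 0"
proof -
  have "A i j = 0" if "j < k" for i j
  proof -
    define R where "R = mat_times k A a"
    have sq: "mat_times k B (adjoint_mat B) i i = (\<Sum>l<k. B i l * star (B i l))" for B :: "nat \<Rightarrow> nat \<Rightarrow> 'a"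
      by (simp add: mat_times_def adjoint_mat_def)
    have "mat_times k (A + mat_times k A (mat_times k a (adjoint_mat a))) (adjoint_mat A) = 0"
      unfolding assms(2) by (simp add: mat_times_def fun_eq_iff)
    then have "mat_times k A (adjoint_mat A) + mat_times k R (adjoint_mat R) = 0"
      by (simp add: R_def mat_times_distrib mat_times_assoc)
    then have "(mat_times k A (adjoint_mat A) + mat_times k R (adjoint_mat R)) i i = 0" by simp
    then have "- (\<Sum>l<k. A i l * star (A i l)) = (\<Sum>l<k. R i l * star (R i l))"
      by (simp add: sq minus_unique)
    moreover have "cstar_nonneg (\<Sum>l<k. B i l * star (B i l))" for B :: "nat \<Rightarrow> nat \<Rightarrow> 'a"
      by (intro cstar_nonneg_sum cstar_nonneg_mult_star)
    ultimately have "(\<Sum>l<k. A i l * star (A i l)) = 0"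
      by (intro cstar_nonneg_antisym) simp_all
    then show ?thesis
      using norm_square_le_sum_mult_star[of "{..<k}" j "A i"] that by simp
  qed
  then show ?thesis using assms(1)
    by (auto simp: fun_eq_iff supported_mat_def) (meson not_le)
qed

text \<open>Kaplansky's formula \<open>p = q q\<^sup>* (1 + (q - q\<^sup>*) (q\<^sup>* - q))\<^sup>-\<^sup>1\<close>.\<close>
lemma exists_range_projection:
  fixes q :: "nat \<Rightarrow> nat \<Rightarrow> 'b::unital_cstar_algebra"
  assumes idem: "mat_times k q q = q" and supp: "supported_mat k q"
  obtains p where "supported_mat k p" "adjoint_mat p = p"
    "mat_times k q p = p" "mat_times k p q = q"
proof -
  let ?M = "mat_times k"
  define s where "s = adjoint_mat q"
  define a where "a = q - s"
  define W where "W = ?M a (adjoint_mat a)"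
  define h where "h = ?M q s"
  have ss: "?M s s = s" using arg_cong[OF idem, of adjoint_mat] by (simp add: s_def)
  have qqX: "?M q (?M q X) = ?M q X" and ssX: "?M s (?M s X) = ?M s X" for X
    by (simp_all add: mat_times_assoc[symmetric] idem ss)
  have W: "W = ?M q s + ?M s q - q - s"
    by (simp add: W_def a_def s_def[symmetric])
      (simp add: s_def mat_times_distrib idem ss[unfolded s_def] algebra_simps)
  have Wadj: "adjoint_mat W = W" by (simp add: W_def)
  \<comment> \<open>Both products are \<open>q s q - q\<close>, so \<open>W\<close> commutes with
    \<open>q\<close>; by adjoints also with \<open>s\<close>, hence with \<open>h\<close>.\<close>
  have Wq: "?M W q = ?M q (?M s q) - q" and qW: "?M q W = ?M q (?M s q) - q"
    by (simp_all add: W mat_times_distrib mat_times_assoc idem qqX)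
  have "?M s W = ?M W s"
    using arg_cong[OF trans[OF Wq qW[symmetric]], of adjoint_mat] by (simp add: Wadj s_def)
  then have hW: "?M h W = ?M W h"
    by (simp add: h_def mat_times_assoc) (simp add: mat_times_assoc[symmetric] Wq qW)
  have inj: "A = 0" if "supported_mat k A" "A + ?M A W = 0" for A
    using that eq_0_if_add_mat_times_star unfolding W_def by blast
  have suppW: "supported_mat k W" "supported_mat k h" "supported_mat k s"
    using supp by (auto simp: W h_def s_def intro!: supported_mat_intros supported_mat_adjoint)
  \<comment> \<open>The equation \<open>p + p W = h\<close> is solved one row at a time.\<close>
  have "\<exists>v. \<forall>j<k. (\<Sum>i<k. v i * ((if i = j then 1 else 0) + W i j)) = h l j" for l
  proof (rule positive_definite_row_solvable)
    fix v :: "nat \<Rightarrow> 'b"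
    have row: "(\<Sum>i<k. v i * ((if i = j then 1 else 0) + W i j)) = v j + (\<Sum>i<k. v i * W i j)" if "j < k" for j
      using that by (simp add: distrib_left sum.distrib if_distrib[of "times _"] cong: if_cong)
    \<comment> \<open>All rows of \<open>V\<close> equal \<open>v\<close>, so the form at
      \<open>v\<close> is an entry of a matrix product and associativity applies.\<close>
    define V where "V = (\<lambda>i::nat. v)"
    have "(\<Sum>j<k. (\<Sum>i<k. v i * ((if i = j then 1 else 0) + W i j)) * star (v j)) - (\<Sum>j<k. v j * star (v j))
       = (\<Sum>j<k. (\<Sum>i<k. v i * W i j) * star (v j))"
      using row by (simp add: distrib_right sum.distrib)
    also have "\<dots> = ?M (?M V W) (adjoint_mat V) 0 0"
      by (simp add: mat_times_def V_def adjoint_mat_def)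
    also have "?M (?M V W) (adjoint_mat V) = ?M (?M V a) (adjoint_mat (?M V a))"
      by (simp add: W_def mat_times_assoc)
    also have "\<dots> 0 0 = (\<Sum>j<k. ?M V a 0 j * star (?M V a 0 j))"
      unfolding mat_times_def[of k "?M V a"] adjoint_mat_def ..
    also have "cstar_nonneg \<dots>" by (intro cstar_nonneg_sum cstar_nonneg_mult_star)
    finally show "cstar_nonneg ((\<Sum>j<k. (\<Sum>i<k. v i * ((if i = j then 1 else 0) + W i j)) * star (v j))
       - (\<Sum>j<k. v j * star (v j)))" .
  qed
  then obtain P where P: "\<And>l j. j < k \<Longrightarrow> (\<Sum>i<k. P l i * ((if i = j then 1 else 0) + W i j)) = h l j"
    by metis
  define p where "p = (\<lambda>i j. if i < k \<and> j < k then P i j else 0)"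
  have suppp: "supported_mat k p" by (simp add: p_def supported_mat_def)
  have pW: "p + ?M p W = h"
  proof (intro ext)
    fix l j
    show "(p + ?M p W) l j = h l j"
    proof (cases "l < k \<and> j < k")
      case True
      have "h l j = P l j + (\<Sum>i<k. P l i * W i j)"
        using P[of j l] True by (simp add: distrib_left sum.distrib if_distrib[of "times _"] cong: if_cong)
      also have "\<dots> = p l j + ?M p W l j"
        unfolding mat_times_def using True by (intro arg_cong2[of _ _ _ _ plus] sum.cong) (auto simp: p_def)
      finally show ?thesis by simp
    next
      case False
      moreover have "supported_mat k (p + ?M p W)" by (intro supported_mat_intros suppp suppW)
      ultimately show ?thesis using suppW(2) by (auto simp: supported_mat_def not_less)
    qed
  qed
  \<comment> \<open>Each required identity is checked after right multiplication by
    \<open>1 + W\<close>, which \<open>inj\<close> cancels; here \<open>q h = h\<close> is what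
    matters.\<close>
  have "?M q p - p = 0"
  proof (rule inj)
    have "?M q p - p + ?M (?M q p - p) W = ?M q (p + ?M p W) - (p + ?M p W)"
      by (simp add: mat_times_distrib mat_times_assoc)
    also have "\<dots> = 0" unfolding pW by (simp add: h_def qqX)
    finally show "?M q p - p + ?M (?M q p - p) W = 0" .
  qed (intro supported_mat_intros suppp supp)
  moreover have "?M p q - q = 0"
  proof (rule inj)
    have "?M p q - q + ?M (?M p q - q) W = ?M (p + ?M p W) q - q - ?M q W"
      by (simp add: mat_times_distrib mat_times_assoc Wq qW)
    also have "\<dots> = 0" unfolding pW by (simp add: h_def qW mat_times_assoc)
    finally show "?M p q - q + ?M (?M p q - q) W = 0" .
  qed (intro supported_mat_intros suppp supp)
  moreover have "p - adjoint_mat p = 0"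
  proof (rule inj)
    \<comment> \<open>\<open>D = h - (1 + W) p\<close>. As \<open>W\<close> commutes with
      \<open>h\<close>, \<open>D (1 + W) = 0\<close>, so \<open>(1 + W) p = h\<close>; its adjoint
      is then compared with \<open>p (1 + W) = h\<close>.\<close>
    define D where "D = h - p - ?M W p"
    have hs: "adjoint_mat h = h" by (simp add: h_def s_def)
    have "D + ?M D W = h + ?M h W - (p + ?M p W) - ?M W (p + ?M p W)"
      by (simp add: D_def mat_times_distrib mat_times_assoc)
    also have "\<dots> = 0" unfolding pW hW by simp
    finally have "D + ?M D W = 0" .
    moreover have "supported_mat k D"
      unfolding D_def by (intro supported_mat_intros suppp suppW)
    ultimately have "D = 0" using inj by blast
    then have "adjoint_mat D = 0" by simp
    then have "adjoint_mat h - adjoint_mat p - ?M (adjoint_mat p) W = 0"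
      by (simp only: D_def adjoint_mat_simps Wadj)
    then have "p + ?M p W - adjoint_mat p - ?M (adjoint_mat p) W = 0" by (simp add: hs pW)
    then show "p - adjoint_mat p + ?M (p - adjoint_mat p) W = 0"
      by (simp add: mat_times_distrib algebra_simps)
  qed (intro supported_mat_intros supported_mat_adjoint suppp)
  ultimately show ?thesis using that[of p] suppp by simp
qed

section \<open>Modules and frames\<close>

context left_module
begin

lemma smult_0_left [simp]: "smult 0 x = 0"
  using smult_add_left[of 0 0 x] by simp

lemma smult_0_right [simp]: "smult a 0 = 0"
  using smult_add_right[of a 0 0] by simp

lemma smult_minus_left: "smult (- a) x = - smult a x"
  using smult_add_left[of a "- a" x] by (simp add: minus_unique)

lemma smult_sum_right: "smult a (sum f A) = (\<Sum>i\<in>A. smult a (f i))"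
  by (induction A rule: infinite_finite_induct) (auto simp: smult_add_right)

lemma smult_sum_left: "smult (sum f A) x = (\<Sum>i\<in>A. smult (f i) x)"
  by (induction A rule: infinite_finite_induct) (auto simp: smult_add_left)

text \<open>The family may repeat elements, while the generating sum runs over its image.
  Coefficients are placed on a set \<open>J\<close> of representative indices and are 0
  elsewhere.\<close>

lemma nonzero_generators_expand:
  assumes "nonzero_generators smult k x"
  shows "\<exists>b. m = (\<Sum>i<k. smult (b i) (x i))"
proof -
  obtain c where c: "m = (\<Sum>y\<in>x ` {..<k}. smult (c y) y)"
    using assms unfolding nonzero_generators_def modular_generators_def by blast
  obtain J where J: "J \<subseteq> {..<k}" "inj_on x J" "x ` {..<k} = x ` J"
    using subset_image_inj[of "x ` {..<k}" x "{..<k}"] by auto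
  have "m = (\<Sum>i\<in>J. smult (c (x i)) (x i))" using J c by (simp add: sum.reindex)
  also have "\<dots> = (\<Sum>i<k. smult (if i \<in> J then c (x i) else 0) (x i))"
    using J(1) by (intro sum.mono_neutral_cong_left) auto
  finally show ?thesis by (intro exI)
qed

lemma modular_generators_Diff_0:
  assumes "modular_generators smult X"
  shows "modular_generators smult (X - {0})"
  unfolding modular_generators_def
proof (intro conjI allI)
  fix m
  obtain b where "m = (\<Sum>x\<in>X. smult (b x) x)"
    using assms by (auto simp: modular_generators_def)
  also have "\<dots> = (\<Sum>x\<in>X - {0}. smult (b x) x)"
    using assms by (intro sum.mono_neutral_right) (auto simp: modular_generators_def)
  finally show "\<exists>b. m = (\<Sum>x\<in>X - {0}. smult (b x) x)" by blast
qed (use assms in \<open>simp add: modular_generators_def\<close>)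

text \<open>Coefficients of equal \<open>g j\<close> are added up, since the sum must run over a
  set.\<close>

lemma modular_generators_image:
  fixes n :: nat
  assumes "\<And>m. m = (\<Sum>j<n. smult (a m j) (g j))"
  shows "modular_generators smult (g ` {..<n})"
  unfolding modular_generators_def
proof (intro conjI allI)
  fix m
  have "m = (\<Sum>j<n. smult (a m j) (g j))" by (rule assms)
  also have "\<dots> = (\<Sum>y\<in>g ` {..<n}. \<Sum>j\<in>{j\<in>{..<n}. g j = y}. smult (a m j) (g j))"
    by (rule sum.image_gen) simp
  also have "\<dots> = (\<Sum>y\<in>g ` {..<n}. smult (\<Sum>j\<in>{j\<in>{..<n}. g j = y}. a m j) y)"
    by (simp add: smult_sum_left)
  finally show "\<exists>b. m = (\<Sum>y\<in>g ` {..<n}. smult (b y) y)"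
    by (intro exI[of _ "\<lambda>y. \<Sum>j\<in>{j\<in>{..<n}. g j = y}. a m j"])
qed simp

end

text \<open>\<open>g j\<close> is the preimage of the \<open>P\<close>-component of the
  \<open>j\<close>-th unit vector. Expanding \<open>f m\<close> in unit vectors leaves a part in
  \<open>P\<close> and a part in \<open>Q\<close>; the latter lies in both, so it vanishes.\<close>

lemma fg_projective_dual_basis:
  fixes sM :: "'b::ring_1 \<Rightarrow> 'm::ab_group_add \<Rightarrow> 'm"
  assumes "fg_projective sM"
  shows "\<exists>(n::nat) f g. (\<forall>x y j. f (x + y) j = f x j + f y j) \<and>
    (\<forall>b x j. f (sM b x) j = b * f x j) \<and> (\<forall>m. m = (\<Sum>j<n. sM (f m j) (g j)))"
proof -
  interpret left_module sM using assms by (simp add: fg_projective_def)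
  obtain n P Q f where P: "free_submodule n P" and Q: "free_submodule n Q"
    and PQ: "P \<inter> Q = {\<lambda>_. 0}"
    and dec: "\<forall>v\<in>free_module n. \<exists>p\<in>P. \<exists>q\<in>Q. v = (\<lambda>i. p i + q i)"
    and bij: "bij_betw f UNIV P"
    and add: "\<forall>x y. f (x + y) = (\<lambda>i. f x i + f y i)"
    and sc: "\<forall>b x. f (sM b x) = (\<lambda>i. b * f x i)"
    using assms unfolding fg_projective_def by (elim conjE exE) (rule that)
  note add = add[rule_format] and sc = sc[rule_format]
  have f0: "f 0 = (\<lambda>_. 0)" using add[of 0 0] by (simp add: fun_eq_iff)
  have closed: "v \<in> R \<Longrightarrow> w \<in> R \<Longrightarrow> (\<lambda>i. v i + w i) \<in> R"
    "v \<in> R \<Longrightarrow> (\<lambda>i. c * v i) \<in> R" "(\<lambda>_. 0) \<in> R"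
    if "free_submodule n R" for R v w and c :: 'b
    using that by (simp_all add: free_submodule_def)
  have sumP: "(\<lambda>i. \<Sum>j\<in>J. c j * v j i) \<in> R"
    if R: "free_submodule n R" and v: "\<And>j. v j \<in> R" for R v and c :: "nat \<Rightarrow> 'b" and J :: "nat set"
  proof (induction J rule: infinite_finite_induct)
    case (insert j J)
    then show ?case using closed(1)[OF R closed(2)[OF R v] insert.IH] by simp
  qed (use closed(3)[OF R] in simp_all)
  \<comment> \<open>Zero for \<open>j >= n\<close>, so that every \<open>e j\<close> lies in the
    free module and can be decomposed.\<close>
  define e where "e = (\<lambda>(j::nat) i. if i = j \<and> j < n then 1 else (0::'b))"
  have "e j \<in> free_module n" for j by (auto simp: e_def free_module_def)
  then have "\<exists>p q. p \<in> P \<and> q \<in> Q \<and> e j = (\<lambda>i. p i + q i)" for j using dec by blast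
  then obtain p q where p: "\<And>j. p j \<in> P" and q: "\<And>j. q j \<in> Q"
    and e: "\<And>j. e j = (\<lambda>i. p j i + q j i)" by metis
  have "\<exists>m. f m = p j" for j using bij p[of j] by (metis bij_betw_imp_surj_on imageE)
  then obtain g where g: "\<And>j. f (g j) = p j" by metis
  have "m = (\<Sum>j<n. sM (f m j) (g j))" for m
  proof -
    define u where "u = (\<lambda>i. \<Sum>j<n. f m j * p j i)"
    define w where "w = (\<lambda>i. \<Sum>j<n. f m j * q j i)"
    have fm: "f m \<in> P" using bij by (metis UNIV_I bij_betwE)
    have u: "u \<in> P" and w: "w \<in> Q" unfolding u_def w_def by (intro sumP P Q p q)+
    have "f m i = u i + w i" for i
    proof -
      have "u i + w i = (\<Sum>j<n. f m j * e j i)"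
        by (simp add: u_def w_def e sum.distrib distrib_left)
      also have "\<dots> = (\<Sum>j<n. if i = j then f m j else 0)"
        by (intro sum.cong) (auto simp: e_def)
      also have "\<dots> = f m i"
        using fm P by (auto simp: free_submodule_def free_module_def not_less)
      finally show ?thesis by simp
    qed
    then have "w = (\<lambda>i. f m i + (- 1) * u i)" by (simp add: fun_eq_iff)
    moreover have "(\<lambda>i. f m i + (- 1) * u i) \<in> P"
      by (rule closed(1)[OF P fm closed(2)[OF P u]])
    ultimately have "w = (\<lambda>_. 0)" using w PQ by blast
    then have eq: "f m = u" using \<open>\<And>i. f m i = u i + w i\<close> by (simp add: fun_eq_iff)
    have "f (\<Sum>j\<in>J. sM (c j) (g j)) = (\<lambda>i. \<Sum>j\<in>J. c j * p j i)" for c and J :: "nat set"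
      by (induction J rule: infinite_finite_induct) (auto simp: f0 add sc g)
    then have "f (\<Sum>j<n. sM (f m j) (g j)) = u" by (simp only: u_def)
    then have "f (\<Sum>j<n. sM (f m j) (g j)) = f m" by (rule trans[OF _ eq[symmetric]])
    then show ?thesis using bij by (metis UNIV_I bij_betw_def inj_onD)
  qed
  then show ?thesis by (intro exI[of _ n] exI[of _ f] exI[of _ g]) (simp only: add sc simp_thms)
qed

section \<open>Hilbert modules and normalized tight frames\<close>

context hilbert_module
begin

lemma ip_add_left: "ip (x + y) z = ip x z + ip y z"
  using ip_linear[of 1 x 1 y z] by (simp add: smult_one)

lemma ip_smult_left: "ip (smult a x) z = a * ip x z"
  using ip_linear[of a x 0 0 z] by simp

lemma ip_0_left [simp]: "ip 0 z = 0"
  using ip_smult_left[of 0 0 z] by simp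

lemma ip_sum_left: "ip (sum f A) z = (\<Sum>i\<in>A. ip (f i) z)"
  by (induction A rule: infinite_finite_induct) (auto simp: ip_add_left)

lemma ip_add_right: "ip z (x + y) = ip z x + ip z y"
  using ip_add_left[of x y z] by (metis ip_star star_add)

lemma ip_smult_right: "ip z (smult a x) = ip z x * star a"
  using ip_smult_left[of a x z] by (metis ip_star star_mult)

text \<open>Polarisation, with \<open>i\<close> acting on the module through the coefficient algebra.\<close>
lemma frame_polarization:
  assumes "normalized_tight_frame ip k x"
  shows "ip v w = (\<Sum>i<k. ip v (x i) * ip (x i) w)"
proof -
  define B where "B = (\<lambda>v w. ip v w - (\<Sum>i<k. ip v (x i) * ip (x i) w))"
  have B0: "B v v = 0" for v using assms by (simp add: B_def normalized_tight_frame_def)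
  have add: "B (v + w) z = B v z + B w z" "B z (v + w) = B z v + B z w" for v w z
    by (simp_all add: B_def ip_add_left ip_add_right distrib_left distrib_right sum.distrib)
  have sc: "B (smult a v) z = a * B v z" "B z (smult a v) = B z v * star a" for a v z
    by (simp_all add: B_def ip_smult_left ip_smult_right right_diff_distrib left_diff_distrib
        sum_distrib_left sum_distrib_right mult.assoc)
  have 1: "B v w = - B w v"
    using B0[of "v + w"] B0[of v] B0[of w] by (simp add: add eq_neg_iff_add_eq_0 add.commute)
  \<comment> \<open>\<open>B\<close> is conjugate-linear in its second argument, so replacing
    \<open>v\<close> by \<open>i v\<close> turns skew-symmetry into symmetry.\<close>
  have "B (smult (scaleC \<i> 1) v) w = - B w (smult (scaleC \<i> 1) v)"
    using B0[of "smult (scaleC \<i> 1) v + w"] B0[of "smult (scaleC \<i> 1) v"] B0[of w]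
    by (simp add: add eq_neg_iff_add_eq_0 add.commute)
  then have "scaleC \<i> (B v w) = scaleC \<i> (B w v)"
    by (simp add: sc star_scaleC mult_scaleC_left mult_scaleC_right scaleC_minus_left)
  then have "scaleC (- \<i>) (scaleC \<i> (B v w)) = scaleC (- \<i>) (scaleC \<i> (B w v))" by simp
  then have "B v w = B w v" by (simp add: scaleC_scaleC)
  with 1 have "B v w + B v w = 0" by (metis add.right_inverse)
  then have "2 *\<^sub>R B v w = 0" by (simp add: scaleR_2)
  then show ?thesis by (simp add: B_def)
qed

text \<open>For the difference \<open>d\<close> of the two sides, polarisation gives
  \<open>ip d d = 0\<close>.\<close>

lemma frame_reconstruction:
  assumes "normalized_tight_frame ip k x"
  shows "v = (\<Sum>i<k. smult (ip v (x i)) (x i))"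
proof -
  define d where "d = v + smult (- 1) (\<Sum>i<k. smult (ip v (x i)) (x i))"
  have "ip d d = ip v d - (\<Sum>i<k. ip v (x i) * ip (x i) d)"
    by (subst (1) d_def) (simp add: ip_add_left ip_smult_left ip_sum_left)
  also have "\<dots> = 0" using frame_polarization[OF assms, of v d] by simp
  finally have "d = 0" by (simp add: ip_eq_0_iff)
  then show ?thesis by (simp add: d_def smult_minus_left smult_one)
qed

end

text \<open>Expanding \<open>v\<close> with \<open>ip2\<close> coefficients and \<open>w\<close>
  with \<open>ip1\<close> coefficients turns both inner products into the sum of
  \<open>ip2 v (x i) * ip1 (x i) w\<close>.\<close>

lemma frame_inner_product_unique:
  assumes "hilbert_module smult ip1" "normalized_tight_frame ip1 k x"
    and "hilbert_module smult ip2" "normalized_tight_frame ip2 k x"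
  shows "ip1 = ip2"
proof (intro ext)
  interpret h1: hilbert_module smult ip1 by fact
  interpret h2: hilbert_module smult ip2 by fact
  fix v w
  have "ip1 v w = (\<Sum>i<k. ip2 v (x i) * ip1 (x i) w)"
    using arg_cong[OF h2.frame_reconstruction[OF assms(4), of v], of "\<lambda>v. ip1 v w"]
    by (simp add: h1.ip_sum_left h1.ip_smult_left)
  also have "\<dots> = (\<Sum>i<k. ip2 v (x i) * star (ip1 w (x i)))"
    by (simp flip: h1.ip_star)
  also have "\<dots> = star (\<Sum>i<k. ip1 w (x i) * ip2 (x i) v)"
    by (simp add: star_sum star_mult h2.ip_star[of v, symmetric])
  also have "(\<Sum>i<k. ip1 w (x i) * ip2 (x i) v) = ip2 w v"
    using arg_cong[OF h1.frame_reconstruction[OF assms(2), of w], of "\<lambda>w. ip2 w v"]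
    by (simp add: h2.ip_sum_left h2.ip_smult_left)
  also have "star \<dots> = ip2 v w" by (rule h2.ip_star[symmetric])
  finally show "ip1 v w = ip2 v w" .
qed

text \<open>Equal Gram matrices and polarisation make \<open>f\<close> and \<open>g\<close> preserve
  frame coefficients; reconstruction then shows that they are mutually inverse.\<close>

lemma isomorphic_if_gram_eq:
  fixes sM :: "'b::unital_cstar_algebra \<Rightarrow> 'm::ab_group_add \<Rightarrow> 'm"
    and sN :: "'b \<Rightarrow> 'n::ab_group_add \<Rightarrow> 'n"
  assumes "hilbert_module sM ipM" "normalized_tight_frame ipM k x"
    and "hilbert_module sN ipN" "normalized_tight_frame ipN k y"
    and gram: "\<And>i j. i < k \<Longrightarrow> j < k \<Longrightarrow> ipM (x i) (x j) = ipN (y i) (y j)"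
  shows "isomorphic_modules sM sN"
proof -
  interpret M: hilbert_module sM ipM by fact
  interpret N: hilbert_module sN ipN by fact
  define f where "f = (\<lambda>v. \<Sum>i<k. sN (ipM v (x i)) (y i))"
  define g where "g = (\<lambda>v. \<Sum>i<k. sM (ipN v (y i)) (x i))"
  have gf: "g (f v) = v" for v
  proof -
    have "ipN (f v) (y j) = ipM v (x j)" if "j < k" for j
      using that gram M.frame_polarization[OF assms(2), of v "x j"]
      by (simp add: f_def N.ip_sum_left N.ip_smult_left)
    then show ?thesis using M.frame_reconstruction[OF assms(2), of v] by (simp add: g_def)
  qed
  have fg: "f (g v) = v" for v
  proof -
    have "ipM (g v) (x j) = ipN v (y j)" if "j < k" for j
      using that gram N.frame_polarization[OF assms(4), of v "y j"]
      by (simp add: g_def M.ip_sum_left M.ip_smult_left)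
    then show ?thesis using N.frame_reconstruction[OF assms(4), of v] by (simp add: f_def)
  qed
  show ?thesis unfolding isomorphic_modules_def
  proof (intro exI[of _ f] conjI allI)
    show "bij f" using gf fg by (intro o_bij[of g]) (auto simp: fun_eq_iff)
    show "f (v + w) = f v + f w" for v w
      by (simp add: f_def M.ip_add_left N.smult_add_left sum.distrib)
    show "f (sM b v) = sN b (f v)" for b v
      by (simp add: f_def M.ip_smult_left N.smult_sum_right N.smult_smult)
  qed
qed

text \<open>Passing from \<open>q\<close> to \<open>p\<close> makes the coordinates of the
  \<open>x i\<close> the rows of a self-adjoint matrix fixing all coordinate rows. Therefore
  \<open>ip v (x j)\<close> is the coordinate \<open>t v j\<close>, which gives the frame
  identity.\<close>

lemma exists_frame_inner_product:
  fixes sM :: "'b::unital_cstar_algebra \<Rightarrow> 'm::ab_group_add \<Rightarrow> 'm"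
  assumes "fg_projective sM" and gen: "nonzero_generators sM k x"
  shows "\<exists>ip. hilbert_module sM ip \<and> normalized_tight_frame ip k x"
proof -
  interpret left_module sM using assms by (simp add: fg_projective_def)
  obtain n :: nat and f g where
    f: "\<forall>x y j. f (x + y) j = f x j + f y j" "\<forall>b x j. f (sM b x) j = b * f x j"
    and "\<forall>m. m = (\<Sum>j<n. sM (f m j) (g j))"
    using fg_projective_dual_basis[OF assms(1)] by blast
  then have fg: "(\<Sum>j<n. sM (f m j) (g j)) = m" for m by metis
  have "\<forall>m. \<exists>b. (\<Sum>i<k. sM (b i) (x i)) = m"
    using nonzero_generators_expand[OF gen] by metis
  then obtain c where c: "\<And>m. (\<Sum>i<k. sM (c m i) (x i)) = m" by metis
  \<comment> \<open>\<open>c\<close> need not be linear; evaluating it only at the fixed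
    \<open>g j\<close> makes \<open>s\<close> linear.\<close>
  define s where "s = (\<lambda>m i. if i < k then \<Sum>j<n. f m j * c (g j) i else 0)"
  have s_add: "s (v + w) i = s v i + s w i" and s_smult: "s (sM b v) i = b * s v i" for v w b i
    by (simp_all add: s_def f distrib_right sum.distrib sum_distrib_left mult.assoc)
  have s_0: "s 0 i = 0" for i using s_smult[of 0 0 i] by simp
  have s_sum: "s (\<Sum>l\<in>A. sM (b l) (h l)) i = (\<Sum>l\<in>A. b l * s (h l) i)"
    for b :: "nat \<Rightarrow> 'b" and h A i
    by (induction A rule: infinite_finite_induct) (auto simp: s_0 s_add s_smult)
  have s_exp: "(\<Sum>i<k. sM (s m i) (x i)) = m" for m
  proof -
    have "(\<Sum>i<k. sM (s m i) (x i)) = (\<Sum>i<k. \<Sum>j<n. sM (f m j) (sM (c (g j) i) (x i)))"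
      by (simp add: s_def smult_sum_left smult_smult)
    also have "\<dots> = (\<Sum>j<n. sM (f m j) (\<Sum>i<k. sM (c (g j) i) (x i)))"
      by (subst sum.swap) (simp add: smult_sum_right)
    also have "\<dots> = m" using c fg by simp
    finally show ?thesis .
  qed
  define q where "q = (\<lambda>i j. if i < k then s (x i) j else 0)"
  \<comment> \<open>Idempotence of \<open>q\<close> is the case \<open>m = x i\<close>.\<close>
  have sq: "(\<Sum>i<k. s m i * q i j) = s m j" for m j
    using arg_cong[OF s_exp[of m], of "\<lambda>m. s m j"] by (simp add: s_sum q_def)
  have "mat_times k q q = q"
  proof (intro ext)
    fix i j
    show "mat_times k q q i j = q i j"
    proof (cases "i < k")
      case True
      then show ?thesis using sq[of "x i" j] by (simp add: mat_times_def) (simp add: q_def)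
    next
      case False
      then show ?thesis by (simp add: mat_times_def q_def)
    qed
  qed
  moreover have "supported_mat k q" by (auto simp: q_def s_def supported_mat_def)
  ultimately obtain p where p: "supported_mat k p" "adjoint_mat p = p"
    "mat_times k q p = p" "mat_times k p q = q"
    by (rule exists_range_projection)
  have pp: "mat_times k p p = p"
    using arg_cong[OF p(4), of "\<lambda>m. mat_times k m p"] p(3) by (simp add: mat_times_assoc)
  define t where "t = (\<lambda>m j. \<Sum>i<k. s m i * p i j)"
  have t_add: "t (v + w) i = t v i + t w i" and t_smult: "t (sM b v) i = b * t v i" for v w b i
    by (simp_all add: t_def s_add s_smult distrib_right sum.distrib sum_distrib_left mult.assoc)
  have t_x: "t (x i) j = p i j" if "i < k" for i j
    using fun_cong[OF fun_cong[OF p(3)], of i j] that by (simp add: mat_times_def q_def t_def)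
  \<comment> \<open>The row \<open>s m\<close> is read as a matrix with constant rows, to reuse
    associativity.\<close>
  have tp: "(\<Sum>i<k. t m i * p i j) = t m j" for m j
    using fun_cong[OF fun_cong[OF mat_times_assoc[of k "\<lambda>_. s m" p p]], of 0 j]
    unfolding pp by (simp add: mat_times_def t_def)
  \<comment> \<open>\<open>p q = q\<close> recovers \<open>s\<close> from \<open>t\<close>, whence
    \<open>t\<close> is injective.\<close>
  have tq: "(\<Sum>i<k. t m i * q i j) = s m j" for m j
    using fun_cong[OF fun_cong[OF mat_times_assoc[of k "\<lambda>_. s m" p q]], of 0 j]
    unfolding p(4) by (simp add: mat_times_def t_def sq)
  have t_inj: "m = 0" if "\<And>j. j < k \<Longrightarrow> t m j = 0" for m
    using tq[of m] s_exp[of m] that by simp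
  define ip where "ip = (\<lambda>v w. \<Sum>j<k. t v j * star (t w j))"
  have ip_x: "ip v (x j) = t v j" if "j < k" for v j
  proof -
    have "star (p j i) = p i j" for i using fun_cong[OF fun_cong[OF p(2)], of i j] by (simp add: adjoint_mat_def)
    then show ?thesis using that tp[of v j] by (simp add: ip_def t_x)
  qed
  have ip_star: "ip v w = star (ip w v)" for v w
    by (simp add: ip_def star_sum star_mult star_star)
  \<comment> \<open>Serves both definiteness and the passage of Cauchy sequences to
    coordinates.\<close>
  have norm_t: "norm (t v j) \<le> ip_norm ip v" if "j < k" for v j
    using norm_square_le_sum_mult_star[of "{..<k}" j "t v"] that
    by (simp add: ip_norm_def ip_def real_le_rsqrt)
  have t_diff: "t (v - w) j = t v j - t w j" for v w j
    using t_add[of "v - w" w j] by simp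
  have t_sum: "t (\<Sum>l\<in>A. sM (b l) (h l)) i = (\<Sum>l\<in>A. b l * t (h l) i)"
    for b :: "nat \<Rightarrow> 'b" and h A i
    using t_smult[of 0 0 i] by (induction A rule: infinite_finite_induct) (auto simp: t_add t_smult)
  have "hilbert_module sM ip"
  proof
    show "positive (ip v v)" for v
      unfolding ip_def by (intro cstar_nonneg_imp_positive cstar_nonneg_sum cstar_nonneg_mult_star)
    show "ip v v = 0 \<longleftrightarrow> v = 0" for v
    proof
      assume "ip v v = 0"
      then have "t v j = 0" if "j < k" for j using norm_t[OF that, of v] by (simp add: ip_norm_def)
      then show "v = 0" by (rule t_inj)
    next
      show "v = 0 \<Longrightarrow> ip v v = 0" using t_diff[of 0 0] by (simp add: ip_def)
    qed
    show "ip v w = star (ip w v)" for v w by (rule ip_star)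
    show "ip (sM a v + sM b w) z = a * ip v z + b * ip w z" for a b v w z
      by (simp add: ip_def t_add t_smult distrib_right sum.distrib sum_distrib_left mult.assoc)
    show "\<exists>l. (\<lambda>n. ip_norm ip (X n - l)) \<longlonglongrightarrow> 0"
      if X: "\<forall>e>0. \<exists>N. \<forall>m\<ge>N. \<forall>n\<ge>N. ip_norm ip (X m - X n) < e" for X
    proof -
      have "convergent (\<lambda>n. t (X n) j)" if j: "j < k" for j
      proof (rule Cauchy_convergent, rule CauchyI)
        fix e :: real assume "e > 0"
        with X obtain N where N: "\<And>m n. m \<ge> N \<Longrightarrow> n \<ge> N \<Longrightarrow> ip_norm ip (X m - X n) < e" by blast
        have "norm (t (X m) j - t (X n) j) < e" if "m \<ge> N" "n \<ge> N" for m n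
          using norm_t[OF j, of "X m - X n"] N[OF that] by (simp add: t_diff)
        then show "\<exists>N. \<forall>m\<ge>N. \<forall>n\<ge>N. norm (t (X m) j - t (X n) j) < e" by blast
      qed
      then obtain b where b: "\<And>j. j < k \<Longrightarrow> (\<lambda>n. t (X n) j) \<longlonglongrightarrow> b j"
        unfolding convergent_def by metis
      \<comment> \<open>The coordinates of \<open>l\<close> are \<open>b p\<close>, the limit of
        \<open>t (X n) p = t (X n)\<close>.\<close>
      define l where "l = (\<Sum>i<k. sM (b i) (x i))"
      have lim: "(\<lambda>n. t (X n - l) j) \<longlonglongrightarrow> 0" for j
      proof -
        have "(\<lambda>n. \<Sum>i<k. t (X n) i * p i j) \<longlonglongrightarrow> (\<Sum>i<k. b i * p i j)"
          by (intro tendsto_sum tendsto_mult_right b) auto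
        also have "(\<Sum>i<k. b i * p i j) = t l j" by (simp add: l_def t_sum t_x)
        finally have "(\<lambda>n. t (X n) j) \<longlonglongrightarrow> t l j" unfolding tp .
        then show ?thesis by (simp add: t_diff LIM_zero)
      qed
      have "(\<lambda>n. ip (X n - l) (X n - l)) \<longlonglongrightarrow> (\<Sum>j<k. 0 * star 0)"
        unfolding ip_def by (intro tendsto_sum tendsto_mult lim bounded_linear.tendsto[OF bounded_linear_star])
      then have "(\<lambda>n. ip_norm ip (X n - l)) \<longlonglongrightarrow> sqrt (norm (0::'b))"
        unfolding ip_norm_def by (intro tendsto_real_sqrt tendsto_norm) simp
      then show ?thesis by auto
    qed
  qed
  moreover have "normalized_tight_frame ip k x"
    unfolding normalized_tight_frame_def
  proof
    fix v
    have "ip (x i) v = star (t v i)" if "i < k" for i using ip_star[of "x i" v] ip_x[OF that] by simp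
    then show "ip v v = (\<Sum>i<k. ip v (x i) * ip (x i) v)" using ip_x by (simp add: ip_def)
  qed
  ultimately show ?thesis by blast
qed

section \<open>The frame inner product and its matrix\<close>

lemma frame_inner_product_ex1:
  assumes "fg_projective sM" "nonzero_generators sM k x"
  shows "\<exists>!ip. hilbert_module sM ip \<and> normalized_tight_frame ip k x"
  using exists_frame_inner_product[OF assms] frame_inner_product_unique by blast

lemma frame_inner_product:
  assumes "fg_projective sM" "nonzero_generators sM k x"
  shows "hilbert_module sM (frame_inner_product sM k x)"
    and "normalized_tight_frame (frame_inner_product sM k x) k x"
  using theI'[OF frame_inner_product_ex1[OF assms]] by (simp_all add: frame_inner_product_def)

lemma isomorphic_if_frame_matrix_eq:
  assumes "fg_projective sM" "nonzero_generators sM k x"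
    and "fg_projective sN" "nonzero_generators sN k y"
    and "\<forall>i<k. \<forall>j<k. frame_matrix sM k x i j = frame_matrix sN k y i j"
  shows "isomorphic_modules sM sN"
  using isomorphic_if_gram_eq[OF frame_inner_product[OF assms(1,2)] frame_inner_product[OF assms(3,4)]]
    assms(5) by (simp add: frame_matrix_def)

section \<open>Generating sets of minimal length\<close>

lemma exists_minimal_generators:
  assumes "fg_projective sM"
  obtains X where "modular_generators sM X" "\<And>Y. modular_generators sM Y \<Longrightarrow> card X \<le> card Y"
proof -
  interpret left_module sM using assms by (simp add: fg_projective_def)
  obtain n :: nat and f g where "\<forall>m. m = (\<Sum>j<n. sM (f m j) (g j))"
    using fg_projective_dual_basis[OF assms] by blast
  then have "modular_generators sM (g ` {..<n})"
    by (intro modular_generators_image[where a = f]) (rule spec)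
  then show ?thesis using that ex_has_least_nat[of "modular_generators sM" _ card] by metis
qed

lemma exists_minimal_nonzero_generators:
  assumes "fg_projective sM"
  shows "\<exists>k x. minimal_nonzero_generators sM k x"
proof -
  interpret left_module sM using assms by (simp add: fg_projective_def)
  obtain X where X: "modular_generators sM X" "\<And>Y. modular_generators sM Y \<Longrightarrow> card X \<le> card Y"
    using exists_minimal_generators[OF assms] by blast
  have fin: "finite X" using X(1) by (simp add: modular_generators_def)
  \<comment> \<open>Otherwise discarding 0 would give a smaller generating set.\<close>
  have "0 \<notin> X"
    using X(2)[OF modular_generators_Diff_0[OF X(1)]] fin by (metis card_Diff1_less not_le)
  moreover obtain x where "bij_betw x {..<card X} X"
    using ex_bij_betw_nat_finite[OF fin] by (auto simp: atLeast0LessThan)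
  then have "x ` {..<card X} = X" by (simp add: bij_betw_def)
  ultimately have "minimal_nonzero_generators sM (card X) x"
    using X by (auto simp: minimal_nonzero_generators_def nonzero_generators_def)
  then show ?thesis by blast
qed

theorem corollary3p3:
  fixes sM :: "'b::unital_cstar_algebra \<Rightarrow> 'm::ab_group_add \<Rightarrow> 'm"
    and sN :: "'b \<Rightarrow> 'n::ab_group_add \<Rightarrow> 'n"
  assumes "fg_projective sM"
  shows "(\<forall>k x. nonzero_generators sM k x \<longrightarrow>
            (\<exists>!ip. hilbert_module sM ip \<and> normalized_tight_frame ip k x) \<and>
            (\<forall>i<k. \<forall>j<k. frame_matrix sM k x i j = star (frame_matrix sM k x j i))) \<and>
         (\<forall>k x y. fg_projective sN \<longrightarrow> nonzero_generators sM k x \<longrightarrow> nonzero_generators sN k y \<longrightarrow>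
            (\<forall>i<k. \<forall>j<k. frame_matrix sM k x i j = frame_matrix sN k y i j) \<longrightarrow>
            isomorphic_modules sM sN) \<and>
         (\<exists>X. modular_generators sM X \<and> (\<forall>Y. modular_generators sM Y \<longrightarrow> card X \<le> card Y)) \<and>
         (\<exists>k x. minimal_nonzero_generators sM k x) \<and>
         (\<forall>k x y. fg_projective sN \<longrightarrow>
            minimal_nonzero_generators sM k x \<longrightarrow> minimal_nonzero_generators sN k y \<longrightarrow>
            (\<forall>i<k. \<forall>j<k. frame_matrix sM k x i j = frame_matrix sN k y i j) \<longrightarrow>
            isomorphic_modules sM sN)"
proof (intro conjI)
  show "\<forall>k x. nonzero_generators sM k x \<longrightarrow>
            (\<exists>!ip. hilbert_module sM ip \<and> normalized_tight_frame ip k x) \<and>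
            (\<forall>i<k. \<forall>j<k. frame_matrix sM k x i j = star (frame_matrix sM k x j i))"
    using frame_inner_product_ex1[OF assms] hilbert_module.ip_star[OF frame_inner_product(1)[OF assms]]
    unfolding frame_matrix_def by blast
  show "\<exists>X. modular_generators sM X \<and> (\<forall>Y. modular_generators sM Y \<longrightarrow> card X \<le> card Y)"
    using exists_minimal_generators[OF assms] by metis
  show "\<exists>k x. minimal_nonzero_generators sM k x"
    by (rule exists_minimal_nonzero_generators[OF assms])
qed (use isomorphic_if_frame_matrix_eq[OF assms] in \<open>unfold minimal_nonzero_generators_def, blast+\<close>)

end
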